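(* For every $\varepsilon>0$ there is a constant $C_\varepsilon>0$ such that $$\rho_4(\alpha)\le C_\varepsilon\,\alpha^{5-\varepsilon}\qquad\text{for all } 0<\alpha<1/2 .$$
   Context: $\rho_4(\alpha)$ denotes the minimum asymptotic density of $4$-term arithmetic progressions in a Fourier-uniform set of density $\alpha$, made precise as follows. For $A\subseteq\mathbb{Z}/N\mathbb{Z}$, the density of $A$ is $|A|/N$, and its $4$-AP density is $\Lambda_4(A)=N^{-2}\,\#\{(x,d)\in(\mathbb{Z}/N\mathbb{Z})^2 : x,\,x+d,\,x+2d,\,x+3d\in A\}$. A sequence of sets $A_j\subseteq\mathbb{Z}/N_j\mathbb{Z}$, with $N_j\to\infty$ through primes, is Fourier-uniform if $\max_{r\in\mathbb{Z}/N_j\mathbb{Z},\,r\ne 0}\left|\frac{1}{N_j}\sum_{x\in A_j}e^{-2\pi i r x/N_j}\right|\to 0$ as $j\to\infty$. For $0<\alpha<1$, $\rho_4(\alpha)$ is the infimum of $\liminf_{j\to\infty}\Lambda_4(A_j)$ over all Fourier-uniform sequences $(A_j)$ with $|A_j|/N_j\to\alpha$. *)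

theory Defs
  imports "HOL-Analysis.Analysis" "HOL-Computational_Algebra.Primes"
begin

(* Z/NZ is represented by the residues {..<N}; a subset of Z/NZ is a set A \<subseteq> {..<N},
   and sums in Z/NZ are reduced with mod N. *)

definition density :: "nat \<Rightarrow> nat set \<Rightarrow> real" where
  "density N A = real (card A) / real N"

definition ap4_density :: "nat \<Rightarrow> nat set \<Rightarrow> real" where
  "ap4_density N A =
     real (card {(x, d). x \<in> {..<N} \<and> d \<in> {..<N} \<and> x \<in> A \<and> (x + d) mod N \<in> A \<and>
                         (x + 2 * d) mod N \<in> A \<and> (x + 3 * d) mod N \<in> A}) / (real N)\<^sup>2"

definition fourier_coeff :: "nat \<Rightarrow> nat set \<Rightarrow> nat \<Rightarrow> complex" where
  "fourier_coeff N A r =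
     (\<Sum>x\<in>A. exp (- 2 * of_real pi * \<i> * of_nat r * of_nat x / of_nat N)) / of_nat N"

(* The Max is over a nonempty finite set as soon as N \<ge> 2, in particular for prime N. *)
definition max_nontrivial_fourier :: "nat \<Rightarrow> nat set \<Rightarrow> real" where
  "max_nontrivial_fourier N A = Max ((\<lambda>r. norm (fourier_coeff N A r)) ` {r. r < N \<and> r \<noteq> 0})"

definition fourier_uniform_seq :: "(nat \<Rightarrow> nat) \<Rightarrow> (nat \<Rightarrow> nat set) \<Rightarrow> bool" where
  "fourier_uniform_seq N A \<longleftrightarrow>
     (\<forall>j. prime (N j)) \<and> filterlim N at_top sequentially \<and> (\<forall>j. A j \<subseteq> {..<N j}) \<and>
     (\<lambda>j. max_nontrivial_fourier (N j) (A j)) \<longlonglongrightarrow> 0"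

(* Extended reals, because liminf and INF need a complete lattice. *)
definition rho4 :: "real \<Rightarrow> ereal" where
  "rho4 \<alpha> =
     Inf {liminf (\<lambda>j. ereal (ap4_density (N j) (A j))) | N A.
            fourier_uniform_seq N A \<and> (\<lambda>j. density (N j) (A j)) \<longlonglongrightarrow> \<alpha>}"

end

theory Submission
  imports Defs "HOL-Number_Theory.Cong" "HOL-Real_Asymp.Real_Asymp" "HOL.Binomial_Plus"
begin

text \<open>
  Take a random quadratic \<open>q\<close> and two random linear maps \<open>u, v\<close> on \<open>\<int>/N\<int>\<close>, and let \<open>A\<close> be the set of \<open>x\<close>
  for which \<open>q(x)\<close> lies in the interval of length \<open>\<alpha>N\<close> starting at a point \<open>B(u(x), v(x))\<close>. Every fibre
  of \<open>(u, v)\<close> has density \<open>\<alpha>\<close>, so \<open>A\<close> is Fourier-uniform whatever the function \<open>B\<close> is: the average over \<open>q\<close>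
  of the fourth power of the \<open>U\<^sup>2\<close>-norm of the balanced function is \<open>O(1/N)\<close>.

  Along a progression the third difference of \<open>q\<close> vanishes, and the first three values of \<open>q\<close> are
  independent and uniform. So a progression lies in \<open>A\<close> with probability at most \<open>\<alpha>\<^sup>3\<close>, and only if the
  third difference of \<open>B\<close> is \<open>O(\<alpha>N)\<close>. For a prime \<open>p\<close> close to \<open>1/\<alpha>\<close>, let \<open>B\<close> encode \<open>F(u, v) mod p\<close>, where
  \<open>F\<close> is a binary cubic form without nontrivial zero modulo \<open>p\<close>, together with coarse information that
  excludes wrap-around modulo \<open>N\<close>. The third difference of \<open>F\<close> is \<open>-6 F\<close> evaluated at the common differences
  of \<open>u\<close> and \<open>v\<close>, so both are divisible by \<open>p\<close>, which has probability about \<open>1/p\<^sup>2\<close>. This gives density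
  \<open>O(\<alpha>\<^sup>5)\<close>, up to the loss from having to choose \<open>p\<close> prime.
\<close>

section \<open>Quadratics modulo a prime\<close>

definition quad :: "int \<Rightarrow> int \<Rightarrow> int \<Rightarrow> int \<Rightarrow> int" where
  "quad a b c x = a * x\<^sup>2 + b * x + c"

text \<open>This is the third forward difference at \<open>0\<close> with its sign reversed; it
  reads only the four values along a 4-term progression.\<close>

definition third_diff :: "(nat \<Rightarrow> int) \<Rightarrow> int" where
  "third_diff f = f 0 - 3 * f 1 + 3 * f 2 - f 3"

lemma third_diff_mod_cong:
  assumes "\<And>j. f j mod n = g j mod n"
  shows "third_diff f mod n = third_diff g mod n"
  unfolding third_diff_def by (intro mod_diff_cong mod_add_cong mod_mult_cong assms refl)

lemma third_diff_quad: "third_diff (\<lambda>j. quad a b c (x + int j * d)) = 0"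
  by (simp add: third_diff_def quad_def algebra_simps power2_eq_square)

text \<open>The slope of a chord of a quadratic depends only on the midpoint of the chord's base,
  and the pairs \<open>x, x + h + k\<close> and \<open>x + h, x + k\<close> share theirs.\<close>

lemma quad_parallelogram:
  "(h - k) * (quad a b c (x + h + k) - quad a b c x) =
   (h + k) * (quad a b c (x + h) - quad a b c (x + k))"
  by (simp add: quad_def algebra_simps power2_eq_square)

lemma quad_mod: "quad a b c (x mod n) mod n = quad a b c x mod n"
  unfolding quad_def by (metis mod_add_cong mod_mult_right_eq power_mod mod_mod_trivial)

lemma eq_if_dvd_residue_diff:
  fixes n x y :: int
  assumes "n dvd x - y" "x \<in> {0..<n}" "y \<in> {0..<n}"
  shows "x = y"
proof -
  have "x mod n = y mod n" using assms(1) by (simp add: mod_eq_dvd_iff)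
  then show ?thesis using assms by simp
qed

lemma sum_residues_shift:
  fixes n s :: int and F :: "int \<Rightarrow> 'a::comm_monoid_add"
  assumes n: "n > 0" and per: "\<And>y. F (y mod n) = F y"
  shows "(\<Sum>y\<in>{0..<n}. F (y + s)) = (\<Sum>y\<in>{0..<n}. F y)"
proof -
  have inj: "inj_on (\<lambda>y. (y + s) mod n) {0..<n}"
    by (rule inj_onI) (metis (no_types, lifting) add_diff_cancel_right mod_eq_dvd_iff eq_if_dvd_residue_diff)
  have img: "(\<lambda>y. (y + s) mod n) ` {0..<n} = {0..<n}"
    by (rule endo_inj_surj) (use n inj in auto)
  have "(\<Sum>y\<in>{0..<n}. F y) = (\<Sum>y\<in>{0..<n}. F ((y + s) mod n))"
    by (subst img[symmetric], subst sum.reindex[OF inj]) simp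
  then show ?thesis by (simp add: per)
qed

text \<open>Newton's divided differences: subtracting the values at two nodes leaves a multiple of
  the distance between the nodes, which is invertible modulo \<open>n\<close>. Doing this twice
  isolates the leading coefficient.\<close>

lemma quad_coeffs_unique:
  fixes n :: int
  assumes p: "prime n"
    and dist: "\<not> n dvd x1 - x0" "\<not> n dvd x2 - x0" "\<not> n dvd x2 - x1"
    and e0: "n dvd quad a b c x0 - quad a' b' c' x0"
    and e1: "n dvd quad a b c x1 - quad a' b' c' x1"
    and e2: "n dvd quad a b c x2 - quad a' b' c' x2"
  shows "n dvd a - a' \<and> n dvd b - b' \<and> n dvd c - c'"
proof -
  define A B C where "A = a - a'" "B = b - b'" "C = c - c'"
  have q: "quad a b c x - quad a' b' c' x = A * x\<^sup>2 + B * x + C" for x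
    by (simp add: quad_def A_B_C_def algebra_simps)
  have "n dvd (A * x1\<^sup>2 + B * x1 + C) - (A * x0\<^sup>2 + B * x0 + C)"
    using e0 e1 unfolding q by (rule dvd_diff[rotated])
  also have "\<dots> = (x1 - x0) * (A * (x1 + x0) + B)"
    by (simp add: algebra_simps power2_eq_square)
  finally have 1: "n dvd A * (x1 + x0) + B"
    using p dist by (simp add: prime_dvd_mult_iff)
  have "n dvd (A * x2\<^sup>2 + B * x2 + C) - (A * x0\<^sup>2 + B * x0 + C)"
    using e0 e2 unfolding q by (rule dvd_diff[rotated])
  also have "\<dots> = (x2 - x0) * (A * (x2 + x0) + B)"
    by (simp add: algebra_simps power2_eq_square)
  finally have 2: "n dvd A * (x2 + x0) + B"
    using p dist by (simp add: prime_dvd_mult_iff)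
  have "n dvd (A * (x2 + x0) + B) - (A * (x1 + x0) + B)"
    using 1 2 by (rule dvd_diff[rotated])
  also have "\<dots> = (x2 - x1) * A" by (simp add: algebra_simps)
  finally have A: "n dvd A" using p dist by (simp add: prime_dvd_mult_iff)
  then have B: "n dvd B" using 1 by (metis dvd_add_right_iff dvd_mult2)
  have "n dvd C" using e0 A B unfolding q by (metis dvd_add_right_iff dvd_mult2 dvd_add)
  with A B show ?thesis by (simp add: A_B_C_def)
qed

text \<open>Evaluation at three distinct nodes is an injective map of coefficient triples modulo
  \<open>n\<close>, hence a bijection by finiteness. So a random quadratic takes independent uniform
  values at the nodes.\<close>

lemma sum_quad_interpolation:
  fixes n :: int and F :: "int \<Rightarrow> int \<Rightarrow> int \<Rightarrow> real"
  assumes p: "prime n"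
    and dist: "\<not> n dvd x1 - x0" "\<not> n dvd x2 - x0" "\<not> n dvd x2 - x1"
    and per: "\<And>y0 y1 y2. F (y0 mod n) (y1 mod n) (y2 mod n) = F y0 y1 y2"
  shows "(\<Sum>(a, b, c)\<in>{0..<n} \<times> {0..<n} \<times> {0..<n}.
            F (quad a b c x0) (quad a b c x1) (quad a b c x2)) =
         (\<Sum>(y0, y1, y2)\<in>{0..<n} \<times> {0..<n} \<times> {0..<n}. F y0 y1 y2)"
proof -
  let ?Z = "{0..<n} \<times> {0..<n} \<times> {0..<n}"
  define \<Phi> where "\<Phi> = (\<lambda>(a, b, c). (quad a b c x0 mod n, quad a b c x1 mod n, quad a b c x2 mod n))"
  have n: "n > 0" using p by (simp add: prime_gt_0_int)
  have inj: "inj_on \<Phi> ?Z"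
  proof (rule inj_onI)
    fix s t assume "s \<in> ?Z" "t \<in> ?Z" and eq: "\<Phi> s = \<Phi> t"
    then obtain a b c a' b' c' where st: "s = (a, b, c)" "t = (a', b', c')"
      and r: "a \<in> {0..<n}" "b \<in> {0..<n}" "c \<in> {0..<n}" "a' \<in> {0..<n}" "b' \<in> {0..<n}" "c' \<in> {0..<n}"
      by auto
    have "n dvd a - a' \<and> n dvd b - b' \<and> n dvd c - c'"
      by (rule quad_coeffs_unique[OF p dist]) (use eq in \<open>simp_all add: st \<Phi>_def mod_eq_dvd_iff\<close>)
    then show "s = t" using eq_if_dvd_residue_diff r by (auto simp: st)
  qed
  have img: "\<Phi> ` ?Z = ?Z"
    by (rule endo_inj_surj[OF _ _ inj]) (use n in \<open>auto simp: \<Phi>_def\<close>)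
  have "(\<Sum>(y0, y1, y2)\<in>?Z. F y0 y1 y2) = (\<Sum>s\<in>?Z. case \<Phi> s of (y0, y1, y2) \<Rightarrow> F y0 y1 y2)"
    by (subst img[symmetric], subst sum.reindex[OF inj]) simp
  also have "\<dots> = (\<Sum>(a, b, c)\<in>?Z. F (quad a b c x0) (quad a b c x1) (quad a b c x2))"
    by (rule sum.cong) (auto simp: \<Phi>_def per)
  finally show ?thesis by simp
qed

text \<open>Grouping by the common value \<open>z\<close> of \<open>u\<close> turns the form into a
  sum of squares, one for each fibre.\<close>

lemma sum_same_fibre_nonneg:
  fixes w :: "'i \<Rightarrow> real" and u :: "'i \<Rightarrow> 'z"
  assumes "finite I"
  shows "(\<Sum>i\<in>I. \<Sum>j\<in>I. of_bool (u i = u j) * w i * w j) \<ge> 0"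
proof -
  have "(\<Sum>i\<in>I. \<Sum>j\<in>I. of_bool (u i = u j) * w i * w j) =
        (\<Sum>i\<in>I. \<Sum>z\<in>u ` I. \<Sum>j\<in>I. of_bool (u i = z) * w i * (of_bool (u j = z) * w j))"
  proof (intro sum.cong refl)
    fix i assume i: "i \<in> I"
    have "(\<Sum>z\<in>u ` I. \<Sum>j\<in>I. of_bool (u i = z) * w i * (of_bool (u j = z) * w j)) =
          (\<Sum>z\<in>{u i}. \<Sum>j\<in>I. of_bool (u i = z) * w i * (of_bool (u j = z) * w j))"
      by (rule sum.mono_neutral_right) (use assms i in auto)
    also have "\<dots> = (\<Sum>j\<in>I. of_bool (u i = u j) * w i * w j)"
      by (auto intro!: sum.cong)
    finally show "(\<Sum>j\<in>I. of_bool (u i = u j) * w i * w j) =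
        (\<Sum>z\<in>u ` I. \<Sum>j\<in>I. of_bool (u i = z) * w i * (of_bool (u j = z) * w j))" by simp
  qed
  also have "\<dots> = (\<Sum>z\<in>u ` I. (\<Sum>i\<in>I. of_bool (u i = z) * w i)\<^sup>2)"
    by (subst sum.swap) (simp add: sum_product power2_eq_square)
  also have "\<dots> \<ge> 0" by (intro sum_nonneg) simp
  finally show ?thesis .
qed

text \<open>Positivity of the form at \<open>a - b\<close> yields the analogue of
  \<open>2 * a * b \<le> a^2 + b^2\<close>. It separates a mixed correlation into two pure
  ones.\<close>

lemma sum_same_fibre_le:
  fixes a b :: "'i \<Rightarrow> real" and u :: "'i \<Rightarrow> 'z"
  assumes "finite I"
  shows "2 * (\<Sum>i\<in>I. \<Sum>j\<in>I. of_bool (u i = u j) * a i * b j) \<le>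
         (\<Sum>i\<in>I. \<Sum>j\<in>I. of_bool (u i = u j) * a i * a j) +
         (\<Sum>i\<in>I. \<Sum>j\<in>I. of_bool (u i = u j) * b i * b j)"
proof -
  have sw: "(\<Sum>i\<in>I. \<Sum>j\<in>I. of_bool (u i = u j) * b i * a j) =
        (\<Sum>i\<in>I. \<Sum>j\<in>I. of_bool (u i = u j) * a i * b j)"
    by (subst sum.swap) (auto intro!: sum.cong)
  have "0 \<le> (\<Sum>i\<in>I. \<Sum>j\<in>I. of_bool (u i = u j) * (a i - b i) * (a j - b j))"
    by (rule sum_same_fibre_nonneg[OF assms])
  also have "\<dots> = (\<Sum>i\<in>I. \<Sum>j\<in>I. of_bool (u i = u j) * a i * a j) +
         (\<Sum>i\<in>I. \<Sum>j\<in>I. of_bool (u i = u j) * b i * b j)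
       - ((\<Sum>i\<in>I. \<Sum>j\<in>I. of_bool (u i = u j) * a i * b j) + (\<Sum>i\<in>I. \<Sum>j\<in>I. of_bool (u i = u j) * b i * a j))"
    unfolding sum.distrib[symmetric] sum_subtractf[symmetric]
    by (intro sum.cong refl) (simp add: algebra_simps)
  finally show ?thesis unfolding sw by simp
qed

section \<open>Uniformity of random quadratic level sets\<close>

lemma sum_residue_pairs_shift:
  fixes n s t :: int and G :: "int \<Rightarrow> int \<Rightarrow> 'a::comm_monoid_add"
  assumes n: "n > 0" and per: "\<And>y z. G (y mod n) (z mod n) = G y z"
  shows "(\<Sum>(y, z)\<in>{0..<n} \<times> {0..<n}. G (y + s) (z + t)) = (\<Sum>(y, z)\<in>{0..<n} \<times> {0..<n}. G y z)"
proof -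
  have per1: "G y (z mod n) = G y z" for y z by (metis mod_mod_trivial per)
  have per2: "G (y mod n) z = G y z" for y z by (metis mod_mod_trivial per)
  have "(\<Sum>y\<in>{0..<n}. \<Sum>z\<in>{0..<n}. G (y + s) (z + t)) = (\<Sum>y\<in>{0..<n}. \<Sum>z\<in>{0..<n}. G (y + s) z)"
    by (intro sum.cong refl sum_residues_shift[OF n] per1)
  also have "\<dots> = (\<Sum>y\<in>{0..<n}. \<Sum>z\<in>{0..<n}. G y z)"
    by (rule sum_residues_shift[OF n]) (simp add: per2)
  finally show ?thesis by (simp add: sum.cartesian_product)
qed

text \<open>By the parallelogram law \<open>quad_parallelogram\<close>, the values of a quadratic at \<open>x, x + h, x + k, x + h + k\<close>
  satisfy one linear relation, which has the shape \<open>u i = u j\<close> of a fibre product.\<close>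

definition para_energy :: "int \<Rightarrow> (int \<Rightarrow> real) \<Rightarrow> int \<Rightarrow> int \<Rightarrow> real" where
  "para_energy n f h k =
    (\<Sum>i\<in>{0..<n} \<times> {0..<n}. \<Sum>j\<in>{0..<n} \<times> {0..<n}.
      of_bool (((h - k) * fst i + (h + k) * snd i) mod n = ((h - k) * fst j + (h + k) * snd j) mod n)
      * (f (fst i) * f (snd i)) * (f (fst j) * f (snd j)))"

lemma para_energy_nonneg: "para_energy n f h k \<ge> 0"
  unfolding para_energy_def by (rule sum_same_fibre_nonneg) simp

text \<open>Both sides of the relation have the same coefficients, so translating both pairs by
  \<open>(s, t)\<close> preserves it. This is why the placement of the intervals has no influence on
  the uniformity bound.\<close>

lemma para_energy_shift:
  fixes n :: int
  assumes n: "n > 0" and per: "\<And>y. f (y mod n) = f y"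
  shows "(\<Sum>i\<in>{0..<n} \<times> {0..<n}. \<Sum>j\<in>{0..<n} \<times> {0..<n}.
      of_bool (((h - k) * fst i + (h + k) * snd i) mod n = ((h - k) * fst j + (h + k) * snd j) mod n)
      * (f (fst i - s) * f (snd i - t)) * (f (fst j - s) * f (snd j - t))) = para_energy n f h k"
    (is "?L = _")
proof -
  let ?I = "{0..<n} \<times> {0..<n}"
  define K where "K = (\<lambda>y z y' z'. of_bool (((h - k) * y + (h + k) * z) mod n =
      ((h - k) * y' + (h + k) * z') mod n) * (f (y - s) * f (z - t)) * (f (y' - s) * f (z' - t)))"
  have pers: "f (y mod n - s) = f (y - s)" for y s by (metis mod_diff_left_eq per)
  have m: "((h - k) * (y mod n) + (h + k) * (z mod n)) mod n = ((h - k) * y + (h + k) * z) mod n" for y z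
    by (metis mod_add_cong mod_mult_right_eq)
  have perK: "K (y mod n) (z mod n) y' z' = K y z y' z'" "K y z (y' mod n) (z' mod n) = K y z y' z'"
    for y z y' z'
    by (simp_all add: K_def pers m)
  have sh: "K (y + s) (z + t) (y' + s) (z' + t) = of_bool (((h - k) * y + (h + k) * z) mod n =
      ((h - k) * y' + (h + k) * z') mod n) * (f y * f z) * (f y' * f z')" for y z y' z'
    by (simp add: K_def mod_eq_dvd_iff algebra_simps)
  have "?L = (\<Sum>(y, z)\<in>?I. \<Sum>(y', z')\<in>?I. K y z y' z')"
    by (simp add: K_def case_prod_unfold)
  also have "\<dots> = (\<Sum>(y, z)\<in>?I. \<Sum>(y', z')\<in>?I. K y z (y' + s) (z' + t))"
    unfolding split_beta
    by (intro sum.cong refl sum_residue_pairs_shift[OF n, symmetric, unfolded split_beta] perK)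
  also have "\<dots> = (\<Sum>(y, z)\<in>?I. \<Sum>(y', z')\<in>?I. K (y + s) (z + t) (y' + s) (z' + t))"
    by (rule sum_residue_pairs_shift[OF n, symmetric, where G = "\<lambda>y z. \<Sum>(y', z')\<in>?I. K y z (y' + s) (z' + t)"])
      (simp add: perK)
  also have "\<dots> = para_energy n f h k"
    by (simp add: sh para_energy_def case_prod_unfold)
  finally show ?thesis .
qed

text \<open>By interpolation the first three values are free, and the parallelogram law fixes the
  fourth. The result is a fibre product with one weight for the pair \<open>x, x + h\<close> and one
  for \<open>x + h + k, x + k\<close>; once the weights are separated, the shifts drop out of
  both.\<close>

lemma quad_para_sum_le:
  fixes n :: int
  assumes p: "prime n" and per: "\<And>y. f (y mod n) = f y"
    and nd: "\<not> n dvd h" "\<not> n dvd k" "\<not> n dvd h - k"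
  shows "(\<Sum>(a, b, c)\<in>{0..<n} \<times> {0..<n} \<times> {0..<n}.
      f (quad a b c x - s0) * f (quad a b c (x + h) - s1) *
      (f (quad a b c (x + k) - s2) * f (quad a b c (x + h + k) - s3))) \<le> para_energy n f h k"
    (is "?L \<le> _")
proof -
  let ?Z = "{0..<n}" let ?I = "?Z \<times> ?Z"
  have n: "n > 0" using p by (simp add: prime_gt_0_int)
  define u where "u = (\<lambda>i. ((h - k) * fst i + (h + k) * snd i) mod n)"
  have pers: "f (y mod n - s) = f (y - s)" for y s by (metis mod_diff_left_eq per)
  have um: "u (y mod n, z) = u (y, z)" "u (y, z mod n) = u (y, z)" for y z
    unfolding u_def fst_conv snd_conv
    by (metis mod_add_left_eq mod_mult_right_eq) (metis mod_add_right_eq mod_mult_right_eq)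
  \<comment> \<open>\<open>F\<close> sees only the three free values: the fourth enters through a
    sum over all residues \<open>y3\<close>, of which the relation selects exactly one because
    \<open>h - k\<close> is invertible modulo \<open>n\<close>.\<close>
  define F where "F = (\<lambda>y0 y1 y2. f (y0 - s0) * f (y1 - s1) *
     (\<Sum>y3\<in>?Z. of_bool (u (y0, y1) = u (y3, y2)) * (f (y3 - s3) * f (y2 - s2))))"
  have F: "F (quad a b c x) (quad a b c (x + h)) (quad a b c (x + k)) =
      f (quad a b c x - s0) * f (quad a b c (x + h) - s1) *
      (f (quad a b c (x + k) - s2) * f (quad a b c (x + h + k) - s3))" for a b c
  proof -
    let ?y = "quad a b c (x + h + k) mod n"
    have iff: "u (quad a b c x, quad a b c (x + h)) = u (y3, quad a b c (x + k)) \<longleftrightarrow> y3 = ?y"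
      if "y3 \<in> ?Z" for y3
    proof -
      have "u (quad a b c x, quad a b c (x + h)) = u (y3, quad a b c (x + k)) \<longleftrightarrow>
         n dvd ((h - k) * quad a b c x + (h + k) * quad a b c (x + h)) - ((h - k) * y3 + (h + k) * quad a b c (x + k))"
        by (simp add: u_def mod_eq_dvd_iff)
      also have "((h - k) * quad a b c x + (h + k) * quad a b c (x + h)) - ((h - k) * y3 + (h + k) * quad a b c (x + k))
         = (h - k) * (quad a b c (x + h + k) - y3)"
        using quad_parallelogram[of h k a b c x] by (simp add: algebra_simps)
      also have "n dvd \<dots> \<longleftrightarrow> n dvd quad a b c (x + h + k) - y3"
        using p nd by (simp add: prime_dvd_mult_iff)
      also have "\<dots> \<longleftrightarrow> y3 = ?y" using that by (auto simp flip: mod_eq_dvd_iff)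
      finally show ?thesis .
    qed
    have "(\<Sum>y3\<in>?Z. of_bool (u (quad a b c x, quad a b c (x + h)) = u (y3, quad a b c (x + k))) *
        (f (y3 - s3) * f (quad a b c (x + k) - s2))) =
       (\<Sum>y3\<in>?Z. if y3 = ?y then f (y3 - s3) * f (quad a b c (x + k) - s2) else 0)"
      by (rule sum.cong) (auto simp: iff)
    also have "\<dots> = f (quad a b c (x + h + k) - s3) * f (quad a b c (x + k) - s2)"
      using n by (simp add: pers)
    finally show ?thesis by (simp add: F_def mult_ac)
  qed
  have perF: "F (y0 mod n) (y1 mod n) (y2 mod n) = F y0 y1 y2" for y0 y1 y2
    by (simp add: F_def pers um)
  have d: "\<not> n dvd (x + h) - x" "\<not> n dvd (x + k) - x" "\<not> n dvd (x + k) - (x + h)"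
    using nd by (simp_all add: dvd_diff_commute)
  define a b where "a = (\<lambda>i. f (fst i - s0) * f (snd i - s1))" and "b = (\<lambda>i. f (fst i - s3) * f (snd i - s2))"
  have "?L = (\<Sum>(y0, y1, y2)\<in>?Z \<times> ?Z \<times> ?Z. F y0 y1 y2)"
    using sum_quad_interpolation[OF p d, where F = F, OF perF] by (simp add: F)
  also have "\<dots> = (\<Sum>y0\<in>?Z. \<Sum>y1\<in>?Z. \<Sum>y2\<in>?Z. \<Sum>y3\<in>?Z. of_bool (u (y0, y1) = u (y3, y2)) * a (y0, y1) * b (y3, y2))"
    by (simp add: sum.cartesian_product[symmetric] F_def sum_distrib_left a_def b_def mult_ac)
  also have "\<dots> = (\<Sum>y0\<in>?Z. \<Sum>y1\<in>?Z. \<Sum>y3\<in>?Z. \<Sum>y2\<in>?Z. of_bool (u (y0, y1) = u (y3, y2)) * a (y0, y1) * b (y3, y2))"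
    by (rule sum.cong[OF refl], rule sum.cong[OF refl], rule sum.swap)
  also have "\<dots> = (\<Sum>i\<in>?I. \<Sum>j\<in>?I. of_bool (u i = u j) * a i * b j)"
    by (simp add: sum.cartesian_product')
  finally have "?L = \<dots>" .
  moreover have "(\<Sum>i\<in>?I. \<Sum>j\<in>?I. of_bool (u i = u j) * a i * a j) = para_energy n f h k"
    unfolding u_def a_def by (rule para_energy_shift[where f = f, OF n per])
  moreover have "(\<Sum>i\<in>?I. \<Sum>j\<in>?I. of_bool (u i = u j) * b i * b j) = para_energy n f h k"
    unfolding u_def b_def by (rule para_energy_shift[where f = f, OF n per])
  ultimately show ?thesis
    using sum_same_fibre_le[of ?I u a b] by simp
qed

lemma sum_linear_congruence_eq_1:
  fixes n :: int
  assumes p: "prime n" and D: "\<not> n dvd D"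
  shows "(\<Sum>k\<in>{0..<n}. of_bool (n dvd e + k * D)) = (1::real)"
proof -
  have n: "n > 0" using p by (simp add: prime_gt_0_int)
  have inj: "inj_on (\<lambda>k. (e + k * D) mod n) {0..<n}"
  proof (rule inj_onI)
    fix k k' assume k: "k \<in> {0..<n}" "k' \<in> {0..<n}" and "(e + k * D) mod n = (e + k' * D) mod n"
    then have "n dvd (k - k') * D" by (simp add: mod_eq_dvd_iff algebra_simps)
    then have "n dvd k - k'" using p D by (simp add: prime_dvd_mult_iff)
    then show "k = k'" using eq_if_dvd_residue_diff k by blast
  qed
  have img: "(\<lambda>k. (e + k * D) mod n) ` {0..<n} = {0..<n}"
    by (rule endo_inj_surj[OF _ _ inj]) (use n in auto)
  have "(\<Sum>z\<in>{0..<n}. of_bool (z = 0)) = (\<Sum>k\<in>{0..<n}. of_bool ((e + k * D) mod n = 0) :: real)"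
    by (subst img[symmetric], subst sum.reindex[OF inj]) simp
  moreover have "(\<Sum>z\<in>{0..<n}. of_bool (z = 0)) = (1::real)"
    using n by (simp add: of_bool_def)
  ultimately show ?thesis by (simp add: dvd_eq_mod_eq_0)
qed

text \<open>For a fixed quadruple, the relation is linear in \<open>k\<close>: it has exactly one solution, unless the quadruple
  is additive. Additive quadruples contribute with a favourable sign, by positivity again.\<close>

lemma sum_para_energy_le:
  fixes n :: int
  assumes p: "prime n" and odd: "n > 2"
    and sum0: "(\<Sum>y\<in>{0..<n}. f y) = 0" and bd: "\<And>y. \<bar>f y\<bar> \<le> 1"
    and h: "\<not> n dvd h"
  shows "(\<Sum>k\<in>{0..<n}. para_energy n f h k) \<le> n ^ 3"
proof -
  let ?Z = "{0..<n}" let ?I = "?Z \<times> ?Z"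
  define w where "w = (\<lambda>i. f (fst i) * f (snd i))"
  define u where "u = (\<lambda>i::int \<times> int. (snd i - fst i) mod n)"
  \<comment> \<open>The split is on \<open>D\<close> modulo \<open>n\<close>. If it is nonzero,
    exactly one \<open>k\<close> works. If it is zero, a solution forces \<open>i = j\<close>, as
    \<open>h\<close> and \<open>2\<close> are invertible, and then every \<open>k\<close> works; for
    the other additive quadruples none does.\<close>
  have count: "(\<Sum>k\<in>?Z. of_bool (((h - k) * fst i + (h + k) * snd i) mod n = ((h - k) * fst j + (h + k) * snd j) mod n))
      = 1 - of_bool (u i = u j) + n * (of_bool (i = j) :: real)" if "i \<in> ?I" "j \<in> ?I" for i j
  proof -
    obtain y0 y1 y3 y2 where ij: "i = (y0, y1)" "j = (y3, y2)" by (metis surj_pair)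
    define D where "D = (y1 - y2) - (y0 - y3)"
    have rel: "((h - k) * fst i + (h + k) * snd i) mod n = ((h - k) * fst j + (h + k) * snd j) mod n
        \<longleftrightarrow> n dvd h * ((y0 - y3) + (y1 - y2)) + k * D" for k
      by (simp add: ij D_def mod_eq_dvd_iff algebra_simps)
    have uD: "u i = u j \<longleftrightarrow> n dvd D"
      by (simp add: u_def ij D_def mod_eq_dvd_iff algebra_simps)
    show ?thesis
    proof (cases "n dvd D")
      case False
      then have "i \<noteq> j" by (auto simp: ij D_def)
      with False show ?thesis using sum_linear_congruence_eq_1[OF p False] by (simp add: rel uD)
    next
      case True
      have "n dvd h * ((y0 - y3) + (y1 - y2)) + k * D \<longleftrightarrow> i = j" for k
      proof
        assume "n dvd h * ((y0 - y3) + (y1 - y2)) + k * D"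
        then have "n dvd h * ((y0 - y3) + (y1 - y2))" using True by (metis dvd_add_left_iff dvd_mult)
        then have 1: "n dvd (y0 - y3) + (y1 - y2)" using p h by (simp add: prime_dvd_mult_iff)
        then have "n dvd ((y0 - y3) + (y1 - y2)) - D" using True by (rule dvd_diff)
        then have "n dvd 2 * (y0 - y3)" by (simp add: D_def)
        moreover have "\<not> n dvd 2" using odd zdvd_imp_le by fastforce
        ultimately have 2: "n dvd y0 - y3" using p prime_dvd_multD by blast
        then have "n dvd y1 - y2" using 1 by (metis dvd_add_right_iff)
        with 2 show "i = j" using that eq_if_dvd_residue_diff by (auto simp: ij)
      qed (auto simp: ij D_def)
      with True show ?thesis using odd by (simp add: rel uD)
    qed
  qed
  have "(\<Sum>k\<in>?Z. para_energy n f h k) =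
     (\<Sum>i\<in>?I. \<Sum>j\<in>?I. (\<Sum>k\<in>?Z. of_bool (((h - k) * fst i + (h + k) * snd i) mod n = ((h - k) * fst j + (h + k) * snd j) mod n)) * w i * w j)"
    unfolding para_energy_def sum_distrib_right
    by (subst sum.swap, intro sum.cong refl, subst sum.swap) (simp add: w_def)
  also have "\<dots> = (\<Sum>i\<in>?I. \<Sum>j\<in>?I. (1 - of_bool (u i = u j) + n * (of_bool (i = j))) * w i * w j)"
    by (intro sum.cong refl, subst count) auto
  \<comment> \<open>The first double sum is the fourth power of the sum of \<open>f\<close>, which
    is zero; the second is nonnegative and is subtracted. Only the diagonal is left, at most
    \<open>n\<close> for each of \<open>n^2\<close> pairs.\<close>
  also have "\<dots> = (\<Sum>i\<in>?I. \<Sum>j\<in>?I. w i * w j) - (\<Sum>i\<in>?I. \<Sum>j\<in>?I. of_bool (u i = u j) * w i * w j)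
      + (\<Sum>i\<in>?I. \<Sum>j\<in>?I. n * of_bool (i = j) * w i * w j)"
    unfolding sum.distrib[symmetric] sum_subtractf[symmetric]
    by (intro sum.cong refl) (simp add: algebra_simps)
  also have "(\<Sum>i\<in>?I. \<Sum>j\<in>?I. w i * w j) = (\<Sum>i\<in>?I. w i)\<^sup>2"
    by (simp add: power2_eq_square sum_product)
  also have "(\<Sum>i\<in>?I. w i) = (\<Sum>y\<in>?Z. f y)\<^sup>2"
    by (simp add: w_def power2_eq_square sum_product sum.cartesian_product case_prod_unfold)
  also have "\<dots> = 0" using sum0 by simp
  also have "(\<Sum>i\<in>?I. \<Sum>j\<in>?I. n * of_bool (i = j) * w i * w j) = (\<Sum>i\<in>?I. n * (w i)\<^sup>2)"
  proof (intro sum.cong refl)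
    fix i assume "i \<in> ?I"
    then have "(\<Sum>j\<in>?I. if j = i then n * (w i)\<^sup>2 else 0) = n * (w i)\<^sup>2" by (simp del: mem_Sigma_iff)
    moreover have "(\<Sum>j\<in>?I. n * of_bool (i = j) * w i * w j) = (\<Sum>j\<in>?I. if j = i then n * (w i)\<^sup>2 else 0)"
      by (rule sum.cong) (simp_all add: power2_eq_square)
    ultimately show "(\<Sum>j\<in>?I. n * of_bool (i = j) * w i * w j) = n * (w i)\<^sup>2" by simp
  qed
  also have "(0::real)\<^sup>2 - (\<Sum>i\<in>?I. \<Sum>j\<in>?I. of_bool (u i = u j) * w i * w j) + (\<Sum>i\<in>?I. n * (w i)\<^sup>2)
     \<le> (\<Sum>i\<in>?I. n * (w i)\<^sup>2)"
    using sum_same_fibre_nonneg[of ?I u w] by simp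
  also have "\<dots> \<le> (\<Sum>i\<in>?I. real_of_int n * 1)"
  proof (intro sum_mono mult_left_mono)
    fix i
    have "\<bar>w i\<bar> \<le> 1" unfolding w_def abs_mult using mult_le_one[OF bd _ bd] by simp
    then show "(w i)\<^sup>2 \<le> 1" by (simp add: abs_square_le_1)
  qed (use odd in simp)
  also have "\<dots> = n ^ 3"
    using odd by (simp add: card_cartesian_product power3_eq_cube)
  finally show ?thesis .
qed

text \<open>The sum over \<open>h\<close> is \<open>n^3\<close> times the fourth power of the
  \<open>U^2\<close>-norm, so the bound says that this fourth power is at most \<open>4 / n\<close>
  on average over the \<open>n^3\<close> quadratics. Expanding the square gives a sum over
  parallelograms \<open>x, x + h, x + k, x + h + k\<close>.\<close>

lemma sum_quad_autocorrelation_le: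
  fixes n :: int and f :: "int \<Rightarrow> real" and \<beta> :: "int \<Rightarrow> int"
  assumes p: "prime n" and odd: "n > 2"
    and per: "\<And>y. f (y mod n) = f y"
    and sum0: "(\<Sum>y\<in>{0..<n}. f y) = 0" and bd: "\<And>y. \<bar>f y\<bar> \<le> 1"
    and per\<beta>: "\<And>x. \<beta> (x mod n) = \<beta> x"
  shows "(\<Sum>(a, b, c)\<in>{0..<n} \<times> {0..<n} \<times> {0..<n}. \<Sum>h\<in>{0..<n}.
      (\<Sum>x\<in>{0..<n}. f (quad a b c x - \<beta> x) * f (quad a b c (x + h) - \<beta> (x + h)))\<^sup>2) \<le> 4 * n ^ 5"
    (is "?L \<le> _")
proof -
  let ?Z = "{0..<n}" let ?T = "?Z \<times> ?Z \<times> ?Z"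
  have n: "n > 0" using odd by simp
  define G where "G = (\<lambda>(a, b, c) x. f (quad a b c x - \<beta> x))"
  have perG: "G t (x mod n) = G t x" for t x
  proof -
    obtain a b c where t: "t = (a, b, c)" by (cases t)
    have "(quad a b c (x mod n) - \<beta> (x mod n)) mod n = (quad a b c x - \<beta> x) mod n"
      by (metis mod_diff_left_eq per\<beta> quad_mod)
    then show ?thesis unfolding G_def t by (metis case_prod_conv per)
  qed
  have bdG: "\<bar>G t x\<bar> \<le> 1" for t x by (cases t) (simp add: G_def bd)
  define Q where "Q = (\<lambda>x h k. \<Sum>t\<in>?T. G t x * G t (x + h) * (G t (x + k) * G t (x + h + k)))"
  have sq: "(\<Sum>x\<in>?Z. G t x * G t (x + h))\<^sup>2 =
      (\<Sum>x\<in>?Z. \<Sum>k\<in>?Z. G t x * G t (x + h) * (G t (x + k) * G t (x + h + k)))" for t h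
  proof -
    have "(\<Sum>x\<in>?Z. G t x * G t (x + h))\<^sup>2 =
        (\<Sum>x\<in>?Z. \<Sum>k\<in>?Z. G t x * G t (x + h) * (G t k * G t (k + h)))"
      by (simp add: power2_eq_square sum_product)
    also have "\<dots> = (\<Sum>x\<in>?Z. \<Sum>k\<in>?Z. G t x * G t (x + h) * (G t (k + x) * G t (k + x + h)))"
    proof (rule sum.cong[OF refl], rule sum_residues_shift[OF n, symmetric,
        where F = "\<lambda>y. G t x * G t (x + h) * (G t y * G t (y + h))" for x])
      fix x y show "G t x * G t (x + h) * (G t (y mod n) * G t (y mod n + h)) =
          G t x * G t (x + h) * (G t y * G t (y + h))"
        by (metis mod_add_left_eq perG)
    qed
    finally show ?thesis by (simp add: add_ac)
  qed
  have "?L = (\<Sum>t\<in>?T. \<Sum>h\<in>?Z. (\<Sum>x\<in>?Z. G t x * G t (x + h))\<^sup>2)"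
    by (simp add: G_def case_prod_unfold)
  also have "\<dots> = (\<Sum>t\<in>?T. \<Sum>h\<in>?Z. \<Sum>x\<in>?Z. \<Sum>k\<in>?Z. G t x * G t (x + h) * (G t (x + k) * G t (x + h + k)))"
    by (simp add: sq)
  also have "\<dots> = (\<Sum>h\<in>?Z. \<Sum>x\<in>?Z. \<Sum>k\<in>?Z. Q x h k)"
    unfolding Q_def
    by (subst sum.swap, intro sum.cong refl, subst sum.swap, intro sum.cong refl, rule sum.swap)
  also have "\<dots> = (\<Sum>x\<in>?Z. \<Sum>h\<in>?Z. \<Sum>k\<in>?Z. Q x h k)" by (rule sum.swap)
  also have "\<dots> \<le> (\<Sum>x\<in>?Z. 4 * real_of_int n ^ 4)"
  proof (rule sum_mono)
    fix x assume "x \<in> ?Z"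
    have Qn: "Q x h k \<le> n ^ 3" for h k
    proof -
      have "Q x h k \<le> (\<Sum>t\<in>?T. 1)" unfolding Q_def
      proof (rule sum_mono)
        fix t
        have "\<bar>G t x * G t (x + h) * (G t (x + k) * G t (x + h + k))\<bar> \<le> 1"
          unfolding abs_mult by (intro mult_le_one bdG mult_nonneg_nonneg abs_ge_zero)
        then show "G t x * G t (x + h) * (G t (x + k) * G t (x + h + k)) \<le> 1" by simp
      qed
      then show ?thesis using n by (simp add: card_cartesian_product power3_eq_cube)
    qed
    \<comment> \<open>Interpolation needs \<open>x, x + h, x + k\<close> to be distinct. The three
      degenerate lines of pairs \<open>(h, k)\<close> get the trivial bound \<open>n^3\<close>, so
      each contributes \<open>n^4\<close>; the energies contribute another \<open>n^4\<close>,
      whence the constant \<open>4\<close>.\<close>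
    have QE: "Q x h k \<le> of_bool (h = 0) * n ^ 3 + of_bool (k = 0) * n ^ 3 + of_bool (k = h) * n ^ 3
        + of_bool (h \<noteq> 0) * para_energy n f h k" if "h \<in> ?Z" "k \<in> ?Z" for h k
    proof (cases "h = 0 \<or> k = 0 \<or> k = h")
      case True
      have "real_of_int (n ^ 3) \<le> of_bool (h = 0) * n ^ 3 + of_bool (k = 0) * n ^ 3 + of_bool (k = h) * n ^ 3"
        using True n by auto
      also have "\<dots> \<le> \<dots> + of_bool (h \<noteq> 0) * para_energy n f h k"
        using para_energy_nonneg[of n f h k] by simp
      finally show ?thesis using Qn[of h k] by linarith
    next
      case False
      have nd: "\<not> n dvd h" "\<not> n dvd k" "\<not> n dvd h - k"
        using False that eq_if_dvd_residue_diff[of n h 0] eq_if_dvd_residue_diff[of n k 0]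
          eq_if_dvd_residue_diff[of n h k] n by auto
      have "Q x h k \<le> para_energy n f h k"
        unfolding Q_def G_def split_beta
        using quad_para_sum_le[where f = f, OF p per nd, where x = x and ?s0.0 = "\<beta> x" and ?s1.0 = "\<beta> (x + h)"
          and ?s2.0 = "\<beta> (x + k)" and ?s3.0 = "\<beta> (x + h + k)"]
        by (simp add: case_prod_unfold)
      then show ?thesis using False by simp
    qed
    have ob: "(\<Sum>k\<in>?Z. of_bool (k = z) * real_of_int m) = m" if "z \<in> ?Z" for z m
    proof -
      have "(\<Sum>k\<in>?Z. of_bool (k = z) * real_of_int m) = (\<Sum>k\<in>?Z. if k = z then real_of_int m else 0)"
        by (rule sum.cong) auto
      then show ?thesis using that by simp
    qed
    have "(\<Sum>h\<in>?Z. \<Sum>k\<in>?Z. Q x h k) \<le> (\<Sum>h\<in>?Z. of_bool (h = 0) * real_of_int n ^ 4 + 3 * real_of_int n ^ 3)"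
    proof (rule sum_mono)
      fix h assume h: "h \<in> ?Z"
      have E: "of_bool (h \<noteq> 0) * (\<Sum>k\<in>?Z. para_energy n f h k) \<le> n ^ 3"
      proof (cases "h = 0")
        case False
        then have "\<not> n dvd h" using eq_if_dvd_residue_diff[of n h 0] h n by auto
        then show ?thesis using sum_para_energy_le[where f = f, OF p odd sum0 bd] False by simp
      qed (use n in simp)
      have "(\<Sum>k\<in>?Z. Q x h k) \<le> (\<Sum>k\<in>?Z. of_bool (h = 0) * n ^ 3 + of_bool (k = 0) * n ^ 3 + of_bool (k = h) * n ^ 3
        + of_bool (h \<noteq> 0) * para_energy n f h k)"
        by (rule sum_mono) (rule QE[OF h])
      also have "\<dots> = of_bool (h = 0) * n ^ 4 + n ^ 3 + n ^ 3 + of_bool (h \<noteq> 0) * (\<Sum>k\<in>?Z. para_energy n f h k)"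
        using ob[of 0 "n ^ 3"] ob[of h "n ^ 3"] h n
        by (simp add: sum.distrib sum_distrib_left power_numeral_reduce)
      finally show "(\<Sum>k\<in>?Z. Q x h k) \<le> of_bool (h = 0) * real_of_int n ^ 4 + 3 * real_of_int n ^ 3" using E by simp
    qed
    also have "\<dots> = 4 * n ^ 4"
      using ob[of 0 "n ^ 4"] n by (simp add: sum.distrib power_numeral_reduce)
    finally show "(\<Sum>h\<in>?Z. \<Sum>k\<in>?Z. Q x h k) \<le> 4 * real_of_int n ^ 4" by simp
  qed
  also have "\<dots> = 4 * n ^ 5" using n by (simp add: power_numeral_reduce)
  finally show ?thesis by simp
qed

text \<open>The squared modulus is the Fourier transform of the autocorrelation of \<open>g\<close>;
  the triangle inequality and Cauchy-Schwarz over \<open>h\<close> then give the fourth power. This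
  is how the \<open>U^2\<close>-norm controls Fourier coefficients.\<close>

lemma norm_cis_sum_pow4_le:
  fixes n :: int and g :: "int \<Rightarrow> real" and \<theta> :: real
  assumes n: "n > 0" and perg: "\<And>x. g (x mod n) = g x"
    and pere: "\<And>x. cis (\<theta> * (x mod n)) = cis (\<theta> * x)"
  shows "norm (\<Sum>x\<in>{0..<n}. g x * cis (\<theta> * x)) ^ 4 \<le>
         n * (\<Sum>h\<in>{0..<n}. (\<Sum>x\<in>{0..<n}. g x * g (x + h))\<^sup>2)"
proof -
  let ?Z = "{0..<n}"
  define S where "S = (\<Sum>x\<in>?Z. g x * cis (\<theta> * x))"
  define C where "C = (\<lambda>h. \<Sum>x\<in>?Z. g x * g (x + h))"
  have "S * cnj S = (\<Sum>x\<in>?Z. \<Sum>y\<in>?Z. g x * g y * cis (\<theta> * (y - x)))" (is "_ = ?R")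
  proof -
    have "S * cnj S = cnj S * S" by simp
    also have "\<dots> = (\<Sum>x\<in>?Z. \<Sum>y\<in>?Z. (g x * cnj (cis (\<theta> * x))) * (g y * cis (\<theta> * y)))"
      by (simp add: S_def sum_product)
    also have "\<dots> = ?R"
      by (intro sum.cong refl) (simp add: cis_cnj algebra_simps cis_mult diff_conv_add_uminus del: add_uminus_conv_diff)
    finally show ?thesis .
  qed
  also have "(\<Sum>x\<in>?Z. \<Sum>y\<in>?Z. g x * g y * cis (\<theta> * (y - x))) =
      (\<Sum>x\<in>?Z. \<Sum>h\<in>?Z. g x * g (h + x) * cis (\<theta> * (h + x - x)))"
  proof (rule sum.cong[OF refl])
    fix x
    have per: "cis (\<theta> * (y mod n - x)) = cis (\<theta> * (y - x))" for y
    proof -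
      have "cis (\<theta> * (y mod n - x)) = cis (\<theta> * (y mod n)) * cis (- \<theta> * x)"
        by (simp add: cis_mult algebra_simps)
      also have "\<dots> = cis (\<theta> * (y - x))"
        unfolding pere by (simp add: cis_mult algebra_simps)
      finally show ?thesis .
    qed
    show "(\<Sum>y\<in>?Z. g x * g y * cis (\<theta> * (y - x))) =
      (\<Sum>h\<in>?Z. g x * g (h + x) * cis (\<theta> * (h + x - x)))"
      using sum_residues_shift[OF n, where s = x and F = "\<lambda>y. g x * g y * cis (\<theta> * (y - x))"]
        per perg by simp
  qed
  also have "\<dots> = (\<Sum>h\<in>?Z. C h * cis (\<theta> * h))"
    by (subst sum.swap) (simp add: C_def sum_distrib_right add.commute)
  finally have SS: "S * cnj S = (\<Sum>h\<in>?Z. C h * cis (\<theta> * h))" by simp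
  have "(norm S)\<^sup>2 = norm (S * cnj S)" by (simp add: norm_mult power2_eq_square)
  also have "\<dots> \<le> (\<Sum>h\<in>?Z. norm (C h * cis (\<theta> * h)))" unfolding SS by (rule norm_sum)
  also have "\<dots> = (\<Sum>h\<in>?Z. \<bar>C h\<bar>)" by (simp add: norm_mult)
  finally have "((norm S)\<^sup>2)\<^sup>2 \<le> (\<Sum>h\<in>?Z. \<bar>C h\<bar>)\<^sup>2" by (rule power_mono) simp
  also have "\<dots> \<le> card ?Z * (\<Sum>h\<in>?Z. (C h)\<^sup>2)"
    using sum_squared_le_sum_of_squares[of "\<lambda>h. \<bar>C h\<bar>" ?Z] by (simp add: mult.commute)
  finally show ?thesis using n by (simp add: S_def C_def)
qed

section \<open>Colouring by an anisotropic cubic form\<close>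

text \<open>The homogenisation of \<open>t^3 - t - c\<close>: a zero modulo \<open>p\<close> with
  \<open>y\<close> invertible gives the root \<open>x / y\<close> of that polynomial.\<close>

definition cubic :: "int \<Rightarrow> int \<Rightarrow> int \<Rightarrow> int" where
  "cubic c x y = x ^ 3 - x * y\<^sup>2 - c * y ^ 3"

text \<open>The third difference of a cubic polynomial is \<open>3!\<close> times its leading form
  at the step. The minus sign is that of \<open>third_diff\<close>.\<close>

lemma third_diff_cubic: "third_diff (\<lambda>j. cubic c (x + int j * d) (y + int j * e)) = - 6 * cubic c d e"
  unfolding third_diff_def cubic_def by (simp, algebra)

text \<open>The map sending \<open>t\<close> to \<open>t^3 - t\<close> agrees at \<open>0\<close>
  and \<open>1\<close>, so modulo \<open>p\<close> it is not injective, hence not surjective; any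
  missed value serves as \<open>c\<close>.\<close>

lemma exists_irreducible_cubic:
  fixes p :: int
  assumes p: "prime p"
  shows "\<exists>c. \<forall>t. \<not> p dvd t ^ 3 - t - c"
proof -
  define g where "g = (\<lambda>t::int. (t ^ 3 - t) mod p)"
  have p1: "p > 1" using p by (simp add: prime_gt_1_int)
  have "\<not> inj_on g {0..<p}"
  proof
    assume "inj_on g {0..<p}"
    moreover have "g 0 = g 1" by (simp add: g_def)
    ultimately show False using p1 by (auto dest: inj_onD[where x = 0 and y = 1])
  qed
  then have "g ` {0..<p} \<noteq> {0..<p}"
    using eq_card_imp_inj_on[of "{0..<p}" g] by auto
  moreover have "g ` {0..<p} \<subseteq> {0..<p}" using p1 by (auto simp: g_def)
  ultimately obtain c where c: "c \<in> {0..<p}" "c \<notin> g ` {0..<p}" by blast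
  have "\<not> p dvd t ^ 3 - t - c" for t
  proof
    assume "p dvd t ^ 3 - t - c"
    then have "(t ^ 3 - t) mod p = c" using c(1) by (simp flip: mod_eq_dvd_iff)
    moreover have "((t mod p) ^ 3 - t mod p) mod p = (t ^ 3 - t) mod p"
      by (intro mod_diff_cong) (simp_all add: power_mod)
    ultimately have "g (t mod p) = c" by (simp add: g_def)
    moreover have "g (t mod p) \<in> g ` {0..<p}" by (rule imageI) (use p1 in simp)
    ultimately show False using c(2) by simp
  qed
  then show ?thesis by blast
qed

text \<open>If \<open>y\<close> were invertible, \<open>x / y\<close> would be a root of
  \<open>t^3 - t - c\<close>. So \<open>p\<close> divides \<open>y\<close>, and then it divides
  \<open>x^3\<close>.\<close>

lemma cubic_anisotropic:
  fixes p :: int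
  assumes p: "prime p" and c: "\<And>t. \<not> p dvd t ^ 3 - t - c" and dvd: "p dvd cubic c x y"
  shows "p dvd x \<and> p dvd y"
proof -
  have y: "p dvd y"
  proof (rule ccontr)
    assume "\<not> p dvd y"
    then have "coprime y p" using p by (metis coprime_commute prime_imp_coprime)
    then obtain z where "[y * z = 1] (mod p)" using cong_solve_coprime_int by blast
    then obtain k where "y * z - 1 = p * k" by (auto simp: cong_iff_dvd_diff)
    then have k: "y * z = 1 + p * k" by simp
    have "z ^ 3 * cubic c x y = (x * z) ^ 3 - (x * z) * (y * z)\<^sup>2 - c * (y * z) ^ 3"
      unfolding cubic_def by algebra
    also have "\<dots> = (x * z) ^ 3 - x * z - c - p * (k * (x * z * (2 + p * k) + c * (3 + 3 * p * k + (p * k)\<^sup>2)))"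
      unfolding k by algebra
    finally have "(x * z) ^ 3 - x * z - c = z ^ 3 * cubic c x y + p * (k * (x * z * (2 + p * k) + c * (3 + 3 * p * k + (p * k)\<^sup>2)))"
      by simp
    then have "p dvd (x * z) ^ 3 - x * z - c" using dvd by simp
    with c show False by blast
  qed
  have "cubic c x y = x ^ 3 + y * (- x * y - c * y\<^sup>2)" unfolding cubic_def by algebra
  moreover have "p dvd y * (- x * y - c * y\<^sup>2)" using y by (rule dvd_mult2)
  ultimately have "p dvd x ^ 3" using dvd by (simp add: dvd_add_left_iff)
  then show ?thesis using y p by (simp add: prime_dvd_power_iff)
qed

text \<open>The first second difference of the residues is \<open>n * a\<close>, and the vanishing
  third difference makes the next one equal to it. So the first and last gaps differ by
  \<open>2 * n * a\<close>; as gaps lie strictly between \<open>-n\<close> and \<open>n\<close>,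
  this forces \<open>a = 0\<close>.\<close>

lemma residue_progression_no_wrap:
  fixes n :: int
  assumes n: "n > 0"
    and z: "third_diff (\<lambda>j. (l + int j * d) mod n) = 0"
  shows "\<exists>e. \<forall>j\<le>3. (l + int j * d) mod n = l mod n + int j * e"
proof -
  define A B C D where "A = l mod n" "B = (l + d) mod n" "C = (l + 2 * d) mod n" "D = (l + 3 * d) mod n"
  have r: "0 \<le> A" "A < n" "0 \<le> B" "B < n" "0 \<le> C" "C < n" "0 \<le> D" "D < n"
    using n by (simp_all add: A_B_C_D_def)
  have ABCD: "A - 3 * B + 3 * C - D = 0" using z by (simp add: A_B_C_D_def third_diff_def)
  obtain a0 a1 a2 where a: "A = l - n * a0" "B = l + d - n * a1" "C = l + 2 * d - n * a2"
    unfolding A_B_C_D_def by (metis minus_mult_div_eq_mod)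
  define a where "a = 2 * a1 - a0 - a2"
  have aa: "A - 2 * B + C = n * a" using a by (simp add: a_def algebra_simps)
  have "a = 0"
  proof (rule ccontr)
    assume "a \<noteq> 0"
    then consider "a \<ge> 1" | "a \<le> -1" by linarith
    then show False
    proof cases
      case 1
      then have "n * a \<ge> n * 1" using n by (intro mult_left_mono) auto
      then show False using aa ABCD r by linarith
    next
      case 2
      then have "n * a \<le> n * (-1)" using n by (intro mult_left_mono) auto
      then show False using aa ABCD r by linarith
    qed
  qed
  then have "B = A + (B - A) \<and> C = A + 2 * (B - A) \<and> D = A + 3 * (B - A)"
    using aa ABCD by simp
  moreover have "j = 0 \<or> j = 1 \<or> j = 2 \<or> j = 3" if "j \<le> 3" for j :: nat using that by auto
  ultimately show ?thesis unfolding A_B_C_D_def by (intro exI[of _ "B - A"]) (fastforce simp: A_B_C_D_def)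
qed

text \<open>The quotients \<open>x div 10\<close> and \<open>y div 40\<close> make a wrap-around of either residue sequence visible in the
  third difference of \<open>base\<close> at scale \<open>n\<close>, while the cubic only contributes at scale \<open>n / 250\<close>.\<close>

definition base :: "int \<Rightarrow> int \<Rightarrow> int \<Rightarrow> int \<Rightarrow> int \<Rightarrow> int" where
  "base n p c x y = n div (250 * p) * (cubic c x y mod p) + x div 10 + y div 40"

text \<open>Three scales are read off in turn: multiples of \<open>n / 40\<close> from wrap-around,
  multiples of \<open>w = n div (250 * p)\<close> from the cubic, and below \<open>w\<close> the
  offsets \<open>s\<close> with the rounding errors of the quotients.\<close>

lemma base_third_difference:
  fixes n p m :: int
  assumes n: "n > 0" and p: "p > 0" and w: "4 * m + 8 < n div (250 * p)"
    and x: "\<And>j. x j \<in> {0..<n}" "n dvd third_diff x"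
    and y: "\<And>j. y j \<in> {0..<n}" "n dvd third_diff y"
    and s: "\<And>j. s j \<in> {0..<m}"
    and dvd: "n dvd third_diff (\<lambda>j. base n p c (x j) (y j) + s j)"
  shows "third_diff x = 0" "third_diff y = 0" "p dvd third_diff (\<lambda>j. cubic c (x j) (y j))"
proof -
  define b where "b = (\<lambda>j. base n p c (x j) (y j) + s j)"
  have third_diff_bound: "\<bar>third_diff f\<bar> \<le> 4 * M" if "\<And>j. f j \<in> {0..M}" for f M
    using that[of 0] that[of 1] that[of 2] that[of 3] unfolding third_diff_def atLeastAtMost_iff by linarith
  define w where "w = n div (250 * p)"
  define F where "F = (\<lambda>j. cubic c (x j) (y j) mod p)"
  have m: "m > 0" using s[of 0] by simp
  have w0: "w > 4 * m + 8" using w by (simp add: w_def)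
  have wp: "250 * (w * p) \<le> n"
  proof -
    have "250 * p * w = n - n mod (250 * p)" by (simp add: w_def minus_mod_eq_mult_div)
    moreover have "n mod (250 * p) \<ge> 0" using p by simp
    ultimately show ?thesis by (simp add: mult_ac)
  qed
  have F: "\<bar>third_diff F\<bar> \<le> 4 * (p - 1)" by (rule third_diff_bound) (use p in \<open>simp add: F_def\<close>)
  have "\<bar>w * third_diff F\<bar> \<le> w * (4 * (p - 1))"
    unfolding abs_mult using F w0 m by (intro mult_mono) auto
  then have wF: "\<bar>w * third_diff F\<bar> \<le> 4 * (w * p) - 4 * w" by (simp add: algebra_simps)
  define rx ry where "rx = third_diff (\<lambda>j. x j mod 10)" and "ry = third_diff (\<lambda>j. y j mod 40)"
  have X: "\<bar>rx\<bar> \<le> 36" "\<bar>ry\<bar> \<le> 156"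
    unfolding rx_def ry_def by (rule order.trans[OF third_diff_bound[of _ 9]], simp_all, rule order.trans[OF third_diff_bound[of _ 39]], simp_all)
  have "\<bar>third_diff s\<bar> \<le> 4 * (m - 1)" by (rule third_diff_bound) (use s in force)
  then have S: "\<bar>third_diff s\<bar> \<le> 4 * m - 4" by simp
  have x4: "\<bar>third_diff x\<bar> < 4 * n" and y4: "\<bar>third_diff y\<bar> < 4 * n"
    using third_diff_bound[of x "n - 1"] third_diff_bound[of y "n - 1"] x(1) y(1) by force+
  note bounds = wF[THEN abs_le_D1] wF[THEN abs_le_D2] X[THEN abs_le_D1] X[THEN abs_le_D2]
    S[THEN abs_le_D1] S[THEN abs_le_D2]
    x4[unfolded abs_less_iff, THEN conjunct1] x4[unfolded abs_less_iff, THEN conjunct2]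
    y4[unfolded abs_less_iff, THEN conjunct1] y4[unfolded abs_less_iff, THEN conjunct2]
  have div10: "10 * third_diff (\<lambda>j. x j div 10) = third_diff x - rx"
    by (simp add: third_diff_def rx_def ry_def minus_mod_eq_mult_div[symmetric] algebra_simps)
  have div40: "40 * third_diff (\<lambda>j. y j div 40) = third_diff y - ry"
    by (simp add: third_diff_def rx_def ry_def minus_mod_eq_mult_div[symmetric] algebra_simps)
  have diff_b: "third_diff b = w * third_diff F + third_diff (\<lambda>j. x j div 10) + third_diff (\<lambda>j. y j div 40) + third_diff s"
    by (simp add: third_diff_def b_def base_def w_def F_def algebra_simps)
  \<comment> \<open>The quotients contribute less than
    \<open>4 * n / 10 + 4 * n / 40 = n / 2\<close> up to rounding, and the rest is of order
    \<open>n / 50\<close> at most, so no nonzero multiple of \<open>n\<close> is reached.\<close>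
  have "third_diff b = 0"
  proof (rule ccontr)
    assume "third_diff b \<noteq> 0"
    moreover have "n dvd third_diff b" using dvd by (simp add: b_def)
    ultimately have "n \<le> \<bar>third_diff b\<bar>" using n by (metis dvd_imp_le_int abs_of_pos)
    moreover have "40 * third_diff b = 40 * (w * third_diff F) + 4 * third_diff x - 4 * rx + (third_diff y - ry) + 40 * third_diff s"
      using diff_b div10 div40 by simp
    moreover have "w * p \<ge> w" using p w0 m by simp
    ultimately show False using bounds wp w0 m n by linarith
  qed
  then have eq: "4 * third_diff x + third_diff y = - 40 * (w * third_diff F) + 4 * rx + ry - 40 * third_diff s"
    using diff_b div10 div40 by simp
  obtain \<delta> \<epsilon> where d: "third_diff x = n * \<delta>" "third_diff y = n * \<epsilon>" using x(2) y(2) by (auto elim!: dvdE)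
  have small: "\<delta> < 4" "- 4 < \<delta>" "\<epsilon> < 4" "- 4 < \<epsilon>"
  proof -
    have "n * \<delta> < n * 4" "n * (-4) < n * \<delta>" "n * \<epsilon> < n * 4" "n * (-4) < n * \<epsilon>"
      using x4 y4 d by auto
    then show "\<delta> < 4" "- 4 < \<delta>" "\<epsilon> < 4" "- 4 < \<epsilon>" using n by (simp_all only: mult_less_cancel_left_pos)
  qed
  have "\<bar>n * (4 * \<delta> + \<epsilon>)\<bar> < n * 1"
    unfolding distrib_left mult.left_commute[of n 4] d[symmetric] abs_less_iff
    using eq bounds wp w0 m n by linarith
  then have "\<bar>4 * \<delta> + \<epsilon>\<bar> < 1"
    using n unfolding abs_mult by (simp add: mult_less_cancel_left_pos)
  \<comment> \<open>Here the ratio \<open>4\<close> of the divisors \<open>40\<close> and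
    \<open>10\<close> matters: \<open>4 * \<delta> + \<epsilon> = 0\<close> makes
    \<open>\<epsilon>\<close> a multiple of \<open>4\<close> of absolute value below
    \<open>4\<close>.\<close>
  then have "\<delta> = 0" "\<epsilon> = 0" using small by presburger+
  then have 0: "third_diff x = 0" "third_diff y = 0" using d by auto
  then show "third_diff x = 0" "third_diff y = 0" .
  \<comment> \<open>Without wrap-around only rounding, at most \<open>300 / 40\<close>, and the
    offsets, at most \<open>4 * m - 4\<close>, can balance the cubic part; together they stay below
    \<open>w\<close>.\<close>
  have "\<bar>w * third_diff F\<bar> < w * 1" using eq 0 X S w0 by linarith
  then have "\<bar>third_diff F\<bar> < 1" using w0 m unfolding abs_mult by (simp add: mult_less_cancel_left_pos)
  then have F0: "third_diff F = 0" by simp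
  have "third_diff (\<lambda>j. cubic c (x j) (y j)) mod p = third_diff F mod p"
    by (rule third_diff_mod_cong) (simp add: F_def)
  then show "p dvd third_diff (\<lambda>j. cubic c (x j) (y j))" by (simp add: F0 dvd_eq_mod_eq_0)
qed

section \<open>Counting and averaging over the parameters\<close>

text \<open>A pair of coefficients stands for a linear map, a triple for a quadratic.\<close>

definition lin :: "int \<Rightarrow> int \<times> int \<Rightarrow> int \<Rightarrow> int" where
  "lin n u x = (fst u * x + snd u) mod n"

definition hit :: "int \<Rightarrow> int \<Rightarrow> (int \<Rightarrow> int \<Rightarrow> int) \<Rightarrow> int \<times> int \<times> int \<Rightarrow>
    (int \<times> int) \<times> (int \<times> int) \<Rightarrow> int \<Rightarrow> bool" where
  "hit n m B q l x \<longleftrightarrow>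
    (case q of (a, b, c) \<Rightarrow> quad a b c x - B (lin n (fst l) x) (lin n (snd l) x)) mod n < m"

definition hit_params :: "int \<Rightarrow> ((int \<times> int \<times> int) \<times> (int \<times> int) \<times> (int \<times> int)) set" where
  "hit_params n = ({0..<n} \<times> {0..<n} \<times> {0..<n}) \<times> ({0..<n} \<times> {0..<n}) \<times> ({0..<n} \<times> {0..<n})"

lemma finite_hit_params: "finite (hit_params n)"
  by (simp add: hit_params_def)

lemma card_hit_params: "n \<ge> 0 \<Longrightarrow> real (card (hit_params n)) = n ^ 7"
  by (simp add: hit_params_def card_cartesian_product eval_nat_numeral)

lemma lin_mod: "lin n u (x mod n) = lin n u x"
  unfolding lin_def by (metis mod_add_left_eq mod_mult_right_eq)

lemma lin_progression: "lin n u (x + j * d) = ((fst u * x + snd u) + j * (fst u * d)) mod n"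
  by (simp add: lin_def algebra_simps)

lemma hit_mod: "hit n m B q l (x mod n) = hit n m B q l x"
proof (cases q)
  case (fields a b c)
  show ?thesis
    unfolding hit_def fields case_prod_conv lin_mod mod_diff_cong[OF quad_mod refl] ..
qed

lemma lin_coeffs_unique:
  fixes n :: int
  assumes p: "prime n" and d: "\<not> n dvd d"
    and u: "u \<in> {0..<n} \<times> {0..<n}" "u' \<in> {0..<n} \<times> {0..<n}"
    and eq: "lin n u x = lin n u' x" "lin n u (x + d) = lin n u' (x + d)"
  shows "u = u'"
proof -
  obtain a b a' b' where ab: "u = (a, b)" "u' = (a', b')" by (metis surj_pair)
  have 1: "n dvd (a * x + b) - (a' * x + b')" "n dvd (a * (x + d) + b) - (a' * (x + d) + b')"
    using eq by (simp_all add: lin_def ab mod_eq_dvd_iff)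
  have "n dvd ((a * (x + d) + b) - (a' * (x + d) + b')) - ((a * x + b) - (a' * x + b'))"
    by (rule dvd_diff[OF 1(2) 1(1)])
  also have "\<dots> = (a - a') * d" by (simp add: algebra_simps)
  finally have "n dvd a - a'" using p d by (simp add: prime_dvd_mult_iff)
  then have a: "a = a'" by (rule eq_if_dvd_residue_diff) (use u ab in auto)
  have "n dvd b - b'" using 1(1) by (simp add: a)
  then have "b = b'" by (rule eq_if_dvd_residue_diff) (use u ab in auto)
  with a show ?thesis by (simp add: ab)
qed

text \<open>A parameter is encoded by its first three offsets within the intervals and by the values
  of both linear maps at \<open>x\<close> and \<open>x + d\<close>; interpolation makes this
  injective. The fourth offset serves only to place the linear data in \<open>E\<close>, since the
  third difference of the quadratic vanishes.\<close>

lemma card_progression_hits_le: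
  fixes n m :: int
  assumes p: "prime n" and n3: "n > 3" and d: "\<not> n dvd d"
    and fin: "finite E"
    and E: "\<And>l D l' D' s. \<lbrakk>\<And>j. s j \<in> {0..<m};
        n dvd third_diff (\<lambda>j. B ((l + int j * D) mod n) ((l' + int j * D') mod n) + s j)\<rbrakk>
      \<Longrightarrow> ((l mod n, (l + D) mod n), (l' mod n, (l' + D') mod n)) \<in> E"
  shows "card {(q, l) \<in> hit_params n. \<forall>j\<le>3. hit n m B q l (x + int j * d)} \<le> nat m ^ 3 * card E"
proof -
  let ?H = "{(q, l) \<in> hit_params n. \<forall>j\<le>3. hit n m B q l (x + int j * d)}"
  let ?S = "{0..<m}"
  have n: "n > 0" using n3 by simp
  define s where "s = (\<lambda>(a, b, c) l j. (quad a b c (x + int j * d) -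
     B (lin n (fst l) (x + int j * d)) (lin n (snd l) (x + int j * d))) mod n)"
  define L where "L = (\<lambda>u. (lin n u x, lin n u (x + d)))"
  define \<Psi> where "\<Psi> = (\<lambda>(q, l). ((s q l 0, s q l 1, s q l 2), (L (fst l), L (snd l))))"
  have s_hit: "s q l j \<in> ?S" if "(q, l) \<in> ?H" "j \<le> 3" for q l j
    using that n by (cases q) (auto simp: s_def hit_def)
  have L_in: "(L u, L u') \<in> E" if H: "(q, u, u') \<in> ?H" for q u u'
  proof -
    obtain a b c where q: "q = (a, b, c)" by (metis surj_pair)
    \<comment> \<open>The hypothesis on \<open>E\<close> wants offsets in range for every
      \<open>j\<close>, while hits are known for \<open>j \<le> 3\<close> only. Beyond that
      \<open>t\<close> repeats the offset at \<open>0\<close>, which \<open>third_diff\<close> does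
      not see.\<close>
    define t where "t = (\<lambda>j. if j \<le> 3 then s q (u, u') j else s q (u, u') 0)"
    have t: "t j \<in> ?S" for j using s_hit[OF H] by (simp add: t_def)
    define b' where "b' = (\<lambda>j. B (lin n u (x + int j * d)) (lin n u' (x + int j * d)))"
    have "third_diff (\<lambda>j. b' j + t j) = third_diff (\<lambda>j. b' j + s q (u, u') j)"
      by (simp add: third_diff_def t_def)
    moreover have "third_diff (\<lambda>j. b' j + s q (u, u') j) mod n = third_diff (\<lambda>j. quad a b c (x + int j * d)) mod n"
      by (rule third_diff_mod_cong) (simp add: s_def q b'_def mod_add_right_eq)
    ultimately have "n dvd third_diff (\<lambda>j. b' j + t j)"
      by (simp add: third_diff_quad dvd_eq_mod_eq_0)
    then have "((((fst u * x + snd u) mod n, ((fst u * x + snd u) + fst u * d) mod n)),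
        ((fst u' * x + snd u') mod n, ((fst u' * x + snd u') + fst u' * d) mod n)) \<in> E"
      unfolding b'_def lin_progression by (rule E[OF t])
    then show ?thesis by (simp add: L_def lin_def algebra_simps)
  qed
  have d2: "\<not> n dvd 2 * d"
  proof
    assume "n dvd 2 * d"
    then have "n dvd 2" using p d by (simp add: prime_dvd_mult_iff)
    then show False using n3 zdvd_imp_le by fastforce
  qed
  have inj: "inj_on \<Psi> ?H"
  proof (rule inj_onI)
    fix y y' assume y: "y \<in> ?H" "y' \<in> ?H" "\<Psi> y = \<Psi> y'"
    obtain a b c u v a' b' c' u' v' where yy: "y = ((a, b, c), (u, v))" "y' = ((a', b', c'), (u', v'))"
      by (metis surj_pair)
    have par: "a \<in> {0..<n}" "b \<in> {0..<n}" "c \<in> {0..<n}" "u \<in> {0..<n} \<times> {0..<n}" "v \<in> {0..<n} \<times> {0..<n}"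
      "a' \<in> {0..<n}" "b' \<in> {0..<n}" "c' \<in> {0..<n}" "u' \<in> {0..<n} \<times> {0..<n}" "v' \<in> {0..<n} \<times> {0..<n}"
      using y(1,2) by (auto simp: yy hit_params_def)
    have "u = u'" by (rule lin_coeffs_unique[OF p d, of _ _ x]) (use par y(3) in \<open>auto simp: yy \<Psi>_def L_def\<close>)
    moreover have "v = v'" by (rule lin_coeffs_unique[OF p d, of _ _ x]) (use par y(3) in \<open>auto simp: yy \<Psi>_def L_def\<close>)
    ultimately have uv: "u = u'" "v = v'" by auto
    have se: "s (a, b, c) (u, v) j = s (a', b', c') (u, v) j" if "j \<in> {0, 1, 2}" for j
      using y(3) that by (auto simp: yy \<Psi>_def uv)
    have e: "n dvd quad a b c (x + int j * d) - quad a' b' c' (x + int j * d)" if "j \<in> {0, 1, 2}" for j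
      using se[OF that] by (simp add: s_def mod_eq_dvd_iff)
    have "n dvd a - a' \<and> n dvd b - b' \<and> n dvd c - c'"
    proof (rule quad_coeffs_unique[OF p _ _ _ e[of 0] e[of 1] e[of 2]])
      show "\<not> n dvd x + int 1 * d - (x + int 0 * d)" "\<not> n dvd x + int 2 * d - (x + int 0 * d)"
        "\<not> n dvd x + int 2 * d - (x + int 1 * d)"
        using d d2 by (simp_all add: algebra_simps)
    qed simp_all
    then have "a = a'" "b = b'" "c = c'"
      using eq_if_dvd_residue_diff[of n a a'] eq_if_dvd_residue_diff[of n b b']
        eq_if_dvd_residue_diff[of n c c'] par by auto
    then show "y = y'" by (simp add: yy uv)
  qed
  have "\<Psi> ` ?H \<subseteq> (?S \<times> ?S \<times> ?S) \<times> E"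
  proof
    fix z assume "z \<in> \<Psi> ` ?H"
    then obtain q u u' where H: "(q, u, u') \<in> ?H" and z: "z = \<Psi> (q, u, u')" by auto
    show "z \<in> (?S \<times> ?S \<times> ?S) \<times> E"
      using L_in[OF H] s_hit[OF H, of 0] s_hit[OF H, of 1] s_hit[OF H, of 2] by (simp add: z \<Psi>_def)
  qed
  then have "card ?H \<le> card ((?S \<times> ?S \<times> ?S) \<times> E)"
    by (rule card_inj_on_le[OF inj]) (simp add: fin)
  then show ?thesis by (simp add: card_cartesian_product power3_eq_cube mult_ac)
qed

text \<open>For fixed \<open>y\<close>, members of one residue class modulo \<open>p\<close> are
  told apart by their quotients by \<open>p\<close>, which run over \<open>0\<close> to
  \<open>n div p\<close>.\<close>

lemma card_dvd_diff_pairs_le: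
  fixes n p :: int
  assumes p: "p > 0" and n: "n \<ge> 0"
  shows "card {(y, z) \<in> {0..<n} \<times> {0..<n}. p dvd z - y} \<le> nat (n * (n div p + 1))"
proof -
  have fin: "finite {z \<in> {0..<n}. p dvd z - y}" for y by (rule finite_subset[of _ "{0..<n}"]) auto
  have le: "card {z \<in> {0..<n}. p dvd z - y} \<le> nat (n div p + 1)" for y
  proof -
    have inj: "inj_on (\<lambda>z. z div p) {z \<in> {0..<n}. p dvd z - y}"
    proof (rule inj_onI)
      fix z z' assume z: "z \<in> {z \<in> {0..<n}. p dvd z - y}" "z' \<in> {z \<in> {0..<n}. p dvd z - y}" "z div p = z' div p"
      have "p dvd (z - y) - (z' - y)" by (rule dvd_diff) (use z in auto)
      then have "z mod p = z' mod p" by (simp add: mod_eq_dvd_iff)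
      with z(3) show "z = z'" by (metis div_mult_mod_eq)
    qed
    have "(\<lambda>z. z div p) ` {z \<in> {0..<n}. p dvd z - y} \<subseteq> {0..<n div p + 1}"
      using p by (auto simp: pos_imp_zdiv_nonneg_iff zle_add1_eq_le intro!: zdiv_mono1)
    then have "card {z \<in> {0..<n}. p dvd z - y} \<le> card {0..<n div p + 1}"
      by (rule card_inj_on_le[OF inj]) simp
    then show ?thesis by simp
  qed
  have "{(y, z) \<in> {0..<n} \<times> {0..<n}. p dvd z - y} = (SIGMA y:{0..<n}. {z \<in> {0..<n}. p dvd z - y})"
    by auto
  then have "card {(y, z) \<in> {0..<n} \<times> {0..<n}. p dvd z - y} = (\<Sum>y\<in>{0..<n}. card {z \<in> {0..<n}. p dvd z - y})"
    using card_SigmaI[of "{0..<n}" "\<lambda>y. {z \<in> {0..<n}. p dvd z - y}"] fin by simp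
  also have "\<dots> \<le> (\<Sum>y\<in>{0..<n}. nat (n div p + 1))" by (rule sum_mono) (rule le)
  also have "\<dots> = nat (n * (n div p + 1))" using n p by (simp add: nat_mult_distrib)
  finally show ?thesis .
qed

text \<open>A hit makes the values of both linear maps genuine integer progressions, with steps
  \<open>e\<close> and \<open>e'\<close>, and \<open>p\<close> divides
  \<open>6 * cubic c e e'\<close>. Since \<open>p > 3\<close>, anisotropy gives that
  \<open>p\<close> divides both steps, so \<open>E\<close> can be a product of two sets of pairs
  congruent modulo \<open>p\<close>.\<close>

lemma card_progression_hits_base_le:
  fixes n m p :: int
  assumes n: "prime n" "n > 3" and p: "prime p" "p > 3" and d: "\<not> n dvd d"
    and c: "\<And>t. \<not> p dvd t ^ 3 - t - c" and w: "4 * m + 8 < n div (250 * p)"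
  shows "card {(q, l) \<in> hit_params n. \<forall>j\<le>3. hit n m (base n p c) q l (x + int j * d)} \<le>
     nat m ^ 3 * (nat (n * (n div p + 1)))\<^sup>2"
proof -
  define F where "F = {(y, z) \<in> {0..<n} \<times> {0..<n}. p dvd z - y}"
  have n0: "n > 0" and p0: "p > 0" using n p by auto
  have fin: "finite F" unfolding F_def by (rule finite_subset[of _ "{0..<n} \<times> {0..<n}"]) auto
  have "card {(q, l) \<in> hit_params n. \<forall>j\<le>3. hit n m (base n p c) q l (x + int j * d)} \<le> nat m ^ 3 * card (F \<times> F)"
  proof (rule card_progression_hits_le[OF n d])
    show "finite (F \<times> F)" using fin by simp
  next
    fix l D l' D' :: int and s :: "nat \<Rightarrow> int"
    assume s: "\<And>j. s j \<in> {0..<m}"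
      and dvd: "n dvd third_diff (\<lambda>j. base n p c ((l + int j * D) mod n) ((l' + int j * D') mod n) + s j)"
    have lin: "n dvd third_diff (\<lambda>j. (l + int j * D) mod n)" for l D
    proof -
      have "third_diff (\<lambda>j. (l + int j * D) mod n) mod n = third_diff (\<lambda>j. l + int j * D) mod n"
        by (rule third_diff_mod_cong) simp
      moreover have "third_diff (\<lambda>j. l + int j * D) = 0" by (simp add: third_diff_def)
      ultimately show ?thesis by (simp add: mod_eq_0_iff_dvd)
    qed
    have res: "(l + int j * D) mod n \<in> {0..<n}" for l D j using n0 by simp
    note base = base_third_difference[OF n0 p0 w, where x = "\<lambda>j. (l + int j * D) mod n"
        and y = "\<lambda>j. (l' + int j * D') mod n", OF res lin res lin s dvd]
    have td: "third_diff (\<lambda>j. (l + int j * D) mod n) = 0" "third_diff (\<lambda>j. (l' + int j * D') mod n) = 0"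
      "p dvd third_diff (\<lambda>j. cubic c ((l + int j * D) mod n) ((l' + int j * D') mod n))"
      by (rule base)+
    obtain e e' where e: "\<And>j. j \<le> 3 \<Longrightarrow> (l + int j * D) mod n = l mod n + int j * e"
      "\<And>j. j \<le> 3 \<Longrightarrow> (l' + int j * D') mod n = l' mod n + int j * e'"
      using residue_progression_no_wrap[OF n0 td(1)] residue_progression_no_wrap[OF n0 td(2)] by blast
    have "third_diff (\<lambda>j. cubic c ((l + int j * D) mod n) ((l' + int j * D') mod n)) =
        third_diff (\<lambda>j. cubic c (l mod n + int j * e) (l' mod n + int j * e'))"
      unfolding third_diff_def by (simp only: e order.refl le_numeral_extra zero_le numeral_le_iff one_le_numeral semiring_norm)
    then have "p dvd 6 * cubic c e e'" using td(3) by (simp add: third_diff_cubic)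
    moreover have "\<not> p dvd 6"
    proof
      assume "p dvd 6"
      then have "p dvd 2 \<or> p dvd 3" using p(1) prime_dvd_mult_iff[of p 2 3] by simp
      then show False using p(2) zdvd_imp_le[of p 2] zdvd_imp_le[of p 3] by auto
    qed
    ultimately have "p dvd cubic c e e'" using p(1) prime_dvd_multD by blast
    then have "p dvd e \<and> p dvd e'" by (rule cubic_anisotropic[OF p(1) c])
    moreover have "(l + D) mod n - l mod n = e" "(l' + D') mod n - l' mod n = e'"
      using e(1)[of 1] e(2)[of 1] by auto
    ultimately show "((l mod n, (l + D) mod n), (l' mod n, (l' + D') mod n)) \<in> F \<times> F"
      using n0 by (simp add: F_def)
  qed
  also have "card (F \<times> F) = (card F)\<^sup>2" by (simp add: card_cartesian_product power2_eq_square)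
  also have "nat m ^ 3 * (card F)\<^sup>2 \<le> nat m ^ 3 * (nat (n * (n div p + 1)))\<^sup>2"
    using card_dvd_diff_pairs_le[of p n] p0 n0 by (intro mult_left_mono power_mono) (auto simp: F_def)
  finally show ?thesis .
qed

section \<open>Averaging over the parameters\<close>

lemma exists_le_average:
  fixes X :: "'a \<Rightarrow> real" and b :: real
  assumes "finite S" "S \<noteq> {}" "(\<Sum>s\<in>S. X s) \<le> card S * b"
  shows "\<exists>s\<in>S. X s \<le> b"
proof (rule ccontr)
  assume "\<not> ?thesis"
  then have "(\<Sum>s\<in>S. b) < (\<Sum>s\<in>S. X s)" using assms by (intro sum_strict_mono) auto
  with assms show False by simp
qed

definition balanced :: "int \<Rightarrow> int \<Rightarrow> (int \<Rightarrow> int \<Rightarrow> int) \<Rightarrow> int \<times> int \<times> int \<Rightarrow>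
    (int \<times> int) \<times> (int \<times> int) \<Rightarrow> int \<Rightarrow> real" where
  "balanced n m B q l x = of_bool (hit n m B q l x) - m / n"

text \<open>For fixed linear maps the starting point of the interval is a function of
  \<open>x\<close> alone and plays the role of \<open>\<beta>\<close>. The bound
  \<open>4 * n^5\<close> is then summed over the \<open>n^4\<close> pairs of linear maps.\<close>

lemma sum_balanced_autocorrelation_le:
  fixes n m :: int
  assumes n: "prime n" "n > 3" and m: "0 \<le> m" "m \<le> n"
  shows "(\<Sum>(q, l)\<in>hit_params n. \<Sum>h\<in>{0..<n}.
      (\<Sum>x\<in>{0..<n}. balanced n m B q l x * balanced n m B q l (x + h))\<^sup>2) \<le> 4 * n ^ 9"
proof -
  let ?Z = "{0..<n}"
  define f where "f = (\<lambda>y. of_bool (y mod n < m) - real_of_int m / real_of_int n)"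
  have n0: "n > 0" using n by simp
  have per: "f (y mod n) = f y" for y by (simp add: f_def)
  have bd: "\<bar>f y\<bar> \<le> 1" for y
  proof -
    have "0 \<le> real_of_int m / real_of_int n" "real_of_int m / real_of_int n \<le> 1" using m n0 by auto
    then show ?thesis unfolding f_def
      by (cases "y mod n < m"; simp only: of_bool_eq abs_le_iff) linarith+
  qed
  have "(\<Sum>y\<in>?Z. of_bool (y mod n < m) :: real) = card {y \<in> ?Z. y < m}"
    by (simp add: of_bool_def sum.If_cases Int_def)
  also have "{y \<in> ?Z. y < m} = {0..<m}" using m by auto
  finally have sum0: "(\<Sum>y\<in>?Z. f y) = 0" using n0 m by (simp add: f_def sum_subtractf)
  define Q where "Q = (\<lambda>l (a, b, c). \<Sum>h\<in>?Z. (\<Sum>x\<in>?Z. balanced n m B (a, b, c) l x * balanced n m B (a, b, c) l (x + h))\<^sup>2)"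
  have Q: "(\<Sum>q\<in>?Z \<times> ?Z \<times> ?Z. Q l q) \<le> 4 * n ^ 5" for l
    using sum_quad_autocorrelation_le[OF n(1) _ per sum0 bd, where \<beta> = "\<lambda>x. B (lin n (fst l) x) (lin n (snd l) x)"] n(2)
    by (simp add: Q_def lin_mod balanced_def hit_def f_def case_prod_unfold)
  have "(\<Sum>(q, l)\<in>hit_params n. \<Sum>h\<in>?Z. (\<Sum>x\<in>?Z. balanced n m B q l x * balanced n m B q l (x + h))\<^sup>2)
      = (\<Sum>l\<in>(?Z \<times> ?Z) \<times> (?Z \<times> ?Z). \<Sum>q\<in>?Z \<times> ?Z \<times> ?Z. Q l q)"
    unfolding hit_params_def sum.cartesian_product[symmetric]
    by (subst sum.swap) (simp add: Q_def case_prod_unfold)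
  also have "\<dots> \<le> (\<Sum>l\<in>(?Z \<times> ?Z) \<times> (?Z \<times> ?Z). 4 * real_of_int n ^ 5)"
    by (rule sum_mono) (use Q in simp)
  also have "\<dots> = 4 * n ^ 9"
    using n0 by (simp add: card_cartesian_product power_numeral_reduce)
  finally show ?thesis .
qed

definition hit_progressions :: "int \<Rightarrow> int \<Rightarrow> (int \<Rightarrow> int \<Rightarrow> int) \<Rightarrow> int \<times> int \<times> int \<Rightarrow>
    (int \<times> int) \<times> (int \<times> int) \<Rightarrow> (int \<times> int) set" where
  "hit_progressions n m B q l = {(x, d) \<in> {0..<n} \<times> {0..<n}. \<forall>j\<le>3. hit n m B q l (x + int j * d)}"

text \<open>Double counting. The summand \<open>n\<close> pays for the trivial progressions with
  \<open>d = 0\<close>, where all parameters are allowed.\<close>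

lemma sum_card_hit_progressions_le:
  fixes n m :: int and K :: real
  assumes n: "n > 0" and K: "K \<ge> 0"
    and count: "\<And>x d. \<not> n dvd d \<Longrightarrow>
      card {(q, l) \<in> hit_params n. \<forall>j\<le>3. hit n m B q l (x + int j * d)} \<le> K * n ^ 7"
  shows "(\<Sum>(q, l)\<in>hit_params n. real (card (hit_progressions n m B q l))) \<le> (K * n\<^sup>2 + n) * n ^ 7"
proof -
  let ?Z = "{0..<n}"
  define G where "G = (\<lambda>x d. {(q, l) \<in> hit_params n. \<forall>j\<le>3. hit n m B q l (x + int j * d)})"
  have G: "real (card (G x d)) \<le> K * n ^ 7 + of_bool (d = 0) * n ^ 7" if "d \<in> ?Z" for x d
  proof (cases "d = 0")
    case True
    have "card (G x d) \<le> card (hit_params n)"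
      by (rule card_mono) (auto simp: G_def finite_hit_params)
    then have "real (card (G x d)) \<le> n ^ 7" using card_hit_params[of n] n by simp
    moreover have "0 \<le> K * n ^ 7" using K n by simp
    ultimately show ?thesis using True by simp
  next
    case False
    then have "\<not> n dvd d" using that eq_if_dvd_residue_diff[of n d 0] n by auto
    then show ?thesis using count False by (simp add: G_def)
  qed
  define h where "h = (\<lambda>t z. \<forall>j\<le>3. hit n m B (fst t) (snd t) (fst z + int j * snd z))"
  have card: "real (card {i \<in> A. P i}) = (\<Sum>i\<in>A. of_bool (P i))" if "finite A" for A and P :: "'b \<Rightarrow> bool"
    using that by (simp add: of_bool_def sum.If_cases Int_def)
  have 1: "hit_progressions n m B q l = {z \<in> ?Z \<times> ?Z. h (q, l) z}" for q l
    unfolding hit_progressions_def h_def by auto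
  have 2: "G x d = {t \<in> hit_params n. h t (x, d)}" for x d
    unfolding G_def h_def by auto
  have "(\<Sum>(q, l)\<in>hit_params n. real (card (hit_progressions n m B q l))) =
     (\<Sum>t\<in>hit_params n. \<Sum>z\<in>?Z \<times> ?Z. of_bool (h t z))"
    unfolding 1 by (subst card) (simp_all add: case_prod_unfold)
  also have "\<dots> = (\<Sum>z\<in>?Z \<times> ?Z. \<Sum>t\<in>hit_params n. of_bool (h t z))"
    by (rule sum.swap)
  also have "\<dots> = (\<Sum>z\<in>?Z \<times> ?Z. real (card (G (fst z) (snd z))))"
    unfolding 2 card[OF finite_hit_params] by simp
  also have "\<dots> = (\<Sum>x\<in>?Z. \<Sum>d\<in>?Z. real (card (G x d)))" by (simp add: sum.cartesian_product')
  also have "\<dots> \<le> (\<Sum>x\<in>?Z. \<Sum>d\<in>?Z. K * n ^ 7 + of_bool (d = 0) * n ^ 7)"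
    by (intro sum_mono G)
  also have "\<dots> = (K * n\<^sup>2 + n) * n ^ 7"
  proof -
    have "(\<Sum>d\<in>?Z. of_bool (d = 0) * real_of_int n ^ 7) = (\<Sum>d\<in>?Z. if d = 0 then real_of_int n ^ 7 else 0)"
      by (rule sum.cong) auto
    also have "\<dots> = real_of_int n ^ 7" using n by simp
    finally show ?thesis using n by (simp add: sum.distrib power2_eq_square algebra_simps)
  qed
  finally show ?thesis .
qed

text \<open>Both quantities must be small for the same parameters, so a weighted sum is averaged.
  The energy has mean at most \<open>4 / n\<close>; the weight \<open>sqrt n\<close> costs the
  progression count only \<open>4 / sqrt n\<close>, yet forces the energy to zero.\<close>

lemma exists_hit_params:
  fixes n m :: int and K :: real
  assumes n: "prime n" "n > 3" and m: "0 \<le> m" "m \<le> n" and K: "K \<ge> 0"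
    and count: "\<And>x d. \<not> n dvd d \<Longrightarrow>
      card {(q, l) \<in> hit_params n. \<forall>j\<le>3. hit n m B q l (x + int j * d)} \<le> K * n ^ 7"
  shows "\<exists>q l. card (hit_progressions n m B q l) / n\<^sup>2 \<le> K + 5 / sqrt n \<and>
    (\<Sum>h\<in>{0..<n}. (\<Sum>x\<in>{0..<n}. balanced n m B q l x * balanced n m B q l (x + h))\<^sup>2) / n ^ 3 \<le> (K + 5) / sqrt n"
proof -
  define U where "U = (\<lambda>(q, l). \<Sum>h\<in>{0..<n}. (\<Sum>x\<in>{0..<n}. balanced n m B q l x * balanced n m B q l (x + h))\<^sup>2)"
  define P where "P = (\<lambda>(q, l). real (card (hit_progressions n m B q l)))"
  have n0: "real_of_int n > 0" and n1: "sqrt n \<ge> 1" using n by simp_all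
  have sq: "sqrt n * sqrt n = n" using n0 by simp
  have "(\<Sum>t\<in>hit_params n. P t / n\<^sup>2 + sqrt n * (U t / n ^ 3)) =
      (\<Sum>t\<in>hit_params n. P t) / n\<^sup>2 + sqrt n * ((\<Sum>t\<in>hit_params n. U t) / n ^ 3)"
    by (simp add: sum.distrib sum_divide_distrib sum_distrib_left)
  also have "\<dots> \<le> ((K * n\<^sup>2 + n) * n ^ 7) / n\<^sup>2 + sqrt n * ((4 * n ^ 9) / n ^ 3)"
    using sum_card_hit_progressions_le[of n K m B] sum_balanced_autocorrelation_le[OF n m, of B] n count K n0
    by (intro add_mono divide_right_mono mult_left_mono) (auto simp: U_def P_def)
  also have "\<dots> = n ^ 7 * (K + 1 / n + sqrt n * (4 / n))"
    using n0 by (simp add: field_simps power_numeral_reduce)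
  also have "sqrt n * (4 / n) = 4 / sqrt n" using n0 sq by (simp add: field_simps)
  also have "1 / n \<le> 1 / sqrt n"
  proof -
    have "sqrt n * 1 \<le> sqrt n * sqrt n" using n1 by (intro mult_left_mono) auto
    then show ?thesis unfolding sq using n0 by (intro divide_left_mono) auto
  qed
  also have "K + 1 / sqrt n + 4 / sqrt n = K + 5 / sqrt n" by (simp add: add_divide_distrib[symmetric])
  finally have "(\<Sum>t\<in>hit_params n. P t / n\<^sup>2 + sqrt n * (U t / n ^ 3)) \<le> card (hit_params n) * (K + 5 / sqrt n)"
    using card_hit_params[of n] n by simp
  moreover have "hit_params n \<noteq> {}" using n by (auto simp: hit_params_def)
  ultimately obtain t where t: "P t / n\<^sup>2 + sqrt n * (U t / n ^ 3) \<le> K + 5 / sqrt n"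
    using exists_le_average[of "hit_params n"] finite_hit_params by blast
  have U0: "U t \<ge> 0" by (cases t) (auto simp: U_def intro!: sum_nonneg)
  have P0: "P t \<ge> 0" by (cases t) (auto simp: P_def)
  have "sqrt n * (U t / n ^ 3) \<ge> 0" "P t / n\<^sup>2 \<ge> 0" using U0 P0 n0 by simp_all
  with t have "P t / n\<^sup>2 \<le> K + 5 / sqrt n" and U1: "sqrt n * (U t / n ^ 3) \<le> K + 5 / sqrt n" by linarith+
  moreover have "5 / sqrt n \<le> 5" using n1 by (simp add: field_simps)
  then have "sqrt n * (U t / n ^ 3) \<le> K + 5" using U1 by linarith
  then have "U t / n ^ 3 \<le> (K + 5) / sqrt n" using n1 by (subst pos_le_divide_eq) (auto simp: mult.commute)
  ultimately show ?thesis
    by (intro exI[of _ "fst t"] exI[of _ "snd t"]) (auto simp: P_def U_def case_prod_unfold)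
qed

section \<open>Existence of primes\<close>

text \<open>Nair's argument: \<open>1 / (k * (n choose k))\<close> is the integral of \<open>x^(k - 1) * (1 - x)^(n - k)\<close> over the
  unit interval, so it satisfies a Pascal-type recurrence in \<open>k\<close>.\<close>

lemma mult_choose_dvd_Lcm:
  assumes "k \<le> n"
  shows "Suc k * (Suc n choose Suc k) dvd Lcm {1..Suc n}"
  using assms
proof (induction k arbitrary: n)
  case 0
  then show ?case by (simp del: Lcm_insert add: dvd_Lcm)
next
  case (Suc k)
  then obtain m where m: "n = Suc m" "k \<le> m" by (metis Suc_le_D Suc_le_mono)
  define L where "L = int (Lcm {1..Suc n})"
  define c where "c = int (Suc n choose Suc k)"
  have "Suc k * (Suc m choose Suc k) dvd Lcm {1..Suc m}" by (rule Suc.IH) (rule m)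
  also have "Lcm {1..Suc m} dvd Lcm {1..Suc n}" by (rule Lcm_least) (use m in \<open>auto intro!: dvd_Lcm\<close>)
  finally obtain z1 where z1: "L = int (Suc k) * int (n choose Suc k) * int z1"
    unfolding L_def m(1) dvd_def by (metis of_nat_mult)
  have "Suc k * (Suc n choose Suc k) dvd Lcm {1..Suc n}" using Suc by simp
  then obtain z2 where z2: "L = int (Suc k) * c * int z2"
    unfolding L_def c_def dvd_def by (metis of_nat_mult)
  have "(Suc n - Suc k) * (Suc n choose Suc k) = Suc n * (n choose Suc k)"
    using binomial_absorb_comp[of "Suc n" "Suc k"] by simp
  then have 1: "(int n - int k) * c = (int n + 1) * int (n choose Suc k)"
    using m unfolding c_def by (metis Suc_diff_Suc diff_Suc_Suc le_SucI of_nat_Suc of_nat_diff of_nat_mult add.commute)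
  have "Suc (Suc k) * (Suc n choose Suc (Suc k)) = (n - k) * (Suc n choose Suc k)"
    using binomial_absorption[of "Suc k" "Suc n"] binomial_absorb_comp[of "Suc n" "Suc k"] by simp
  then have 2: "int (Suc (Suc k) * (Suc n choose Suc (Suc k))) = (int n - int k) * c"
    using m unfolding c_def by (metis le_SucI of_nat_diff of_nat_mult)
  \<comment> \<open>The recurrence for the reciprocals, multiplied by \<open>L\<close>, says that
    the cofactor of the next product is \<open>z1 - z2\<close>; in particular it is an
    integer.\<close>
  have "int (Suc k) * ((int z1 - int z2) * ((int n - int k) * c)) =
      int (Suc k) * ((int n - int k) * c) * int z1 - (int n - int k) * (int (Suc k) * c * int z2)"
    by (simp add: algebra_simps)
  also have "int (Suc k) * ((int n - int k) * c) * int z1 = (int n + 1) * L"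
    unfolding 1 z1 by (simp only: mult_ac)
  also have "(int n + 1) * L - (int n - int k) * (int (Suc k) * c * int z2) = int (Suc k) * L"
    unfolding z2[symmetric] by (simp add: algebra_simps)
  finally have "(int z1 - int z2) * ((int n - int k) * c) = L" by simp
  then have "int (Suc (Suc k) * (Suc n choose Suc (Suc k))) dvd L" unfolding 2 by (metis dvd_triv_right)
  then show ?case unfolding L_def by (simp only: int_dvd_int_iff)
qed

text \<open>The multiplicity of a prime in a least common multiple is the maximum over the members.
  With \<open>v > 0\<close> the empty set, whose \<open>Lcm\<close> is \<open>1\<close>, cannot
  occur.\<close>

lemma prime_power_dvd_Lcm:
  fixes q :: nat
  assumes "finite A" "0 \<notin> A" "prime q" "q ^ v dvd Lcm A" "v > 0"
  shows "\<exists>i\<in>A. q ^ v dvd i"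
  using assms(1,2,4)
proof (induction A)
  case empty
  then show ?case using assms(3,5) by (simp add: prime_nat_iff)
next
  case (insert i A)
  have nz: "i \<noteq> 0" "Lcm A \<noteq> 0" using insert by (auto simp: Lcm_0_iff)
  have "v \<le> multiplicity q (lcm i (Lcm A))"
    by (rule multiplicity_geI) (use insert.prems assms(3) nz in \<open>auto simp: lcm_eq_0_iff\<close>)
  then have "v \<le> multiplicity q i \<or> v \<le> multiplicity q (Lcm A)"
    using multiplicity_lcm[OF nz assms(3)] by (simp add: le_max_iff_disj)
  then have "q ^ v dvd i \<or> q ^ v dvd Lcm A"
    by (blast intro: multiplicity_dvd')
  then show ?case using insert by auto
qed

text \<open>Each prime power in the factorisation divides some number up to \<open>n\<close>, so it
  is at most \<open>n\<close>, and at most \<open>Y\<close> primes occur.\<close>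

lemma Lcm_atMost_le:
  fixes n Y :: nat
  assumes n: "n > 0" and Y: "\<And>q. prime q \<Longrightarrow> q \<le> n \<Longrightarrow> q \<le> Y"
  shows "Lcm {1..n} \<le> n ^ Y"
proof -
  let ?L = "Lcm {1..n}"
  have L: "?L \<noteq> 0" by (simp add: Lcm_0_iff)
  have pow: "q ^ multiplicity q ?L \<le> n" and le: "q \<le> n" if "q \<in> prime_factors ?L" for q
  proof -
    have q: "prime q" "q dvd ?L" using that by auto
    have v: "multiplicity q ?L > 0" using that by (simp add: prime_factors_multiplicity)
    have "\<exists>i\<in>{1..n}. q ^ multiplicity q ?L dvd i"
      by (rule prime_power_dvd_Lcm) (use q v multiplicity_dvd in auto)
    then show p: "q ^ multiplicity q ?L \<le> n" by (auto dest: dvd_imp_le)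
    have "q ^ 1 \<le> q ^ multiplicity q ?L"
      by (rule power_increasing) (use v q prime_ge_1_nat in auto)
    with p show "q \<le> n" by simp
  qed
  have "?L = (\<Prod>q\<in>prime_factors ?L. q ^ multiplicity q ?L)"
    using prod_prime_factors[OF L] by simp
  also have "\<dots> \<le> (\<Prod>q\<in>prime_factors ?L. n)"
    by (rule prod_mono) (use pow in auto)
  also have "\<dots> = n ^ card (prime_factors ?L)" by simp
  also have "\<dots> \<le> n ^ Y"
  proof (rule power_increasing)
    have "prime_factors ?L \<subseteq> {1..Y}"
    proof
      fix q assume "q \<in> prime_factors ?L"
      then show "q \<in> {1..Y}" using le[of q] Y[of q] prime_ge_1_nat[of q] by auto
    qed
    then have "card (prime_factors ?L) \<le> card {1..Y}" by (intro card_mono) auto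
    then show "card (prime_factors ?L) \<le> Y" by simp
  qed (use n in simp)
  finally show ?thesis .
qed

text \<open>The lower bound for the central binomial coefficient meets the upper bound for the least
  common multiple that it divides, so the primes up to \<open>2 * N\<close> cannot all be
  small.\<close>

lemma four_power_le_of_primes_bounded:
  fixes N Y :: nat
  assumes N: "N > 0" and Y: "\<And>q. prime q \<Longrightarrow> q \<le> 2 * N \<Longrightarrow> q \<le> Y"
  shows "4 ^ N \<le> 2 * (2 * real N) ^ Y"
proof -
  obtain m where m: "N = Suc m" using N gr0_implies_Suc by blast
  have "Suc m * (Suc (Suc (2 * m)) choose Suc m) dvd Lcm {1..Suc (Suc (2 * m))}"
    by (rule mult_choose_dvd_Lcm) simp
  moreover have "Suc (Suc (2 * m)) = 2 * N" by (simp add: m)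
  ultimately have "N * ((2 * N) choose N) dvd Lcm {1..2 * N}" by (simp only: m)
  then have "N * ((2 * N) choose N) \<le> Lcm {1..2 * N}"
    by (rule dvd_imp_le) (simp add: zero_less_iff_neq_zero Lcm_0_iff)
  also have "\<dots> \<le> (2 * N) ^ Y" by (rule Lcm_atMost_le) (use N Y in auto)
  finally have "real (N * ((2 * N) choose N)) \<le> real ((2 * N) ^ Y)" by (rule of_nat_mono)
  moreover have "4 ^ N / (2 * real N) \<le> real ((2 * N) choose N)"
    by (rule central_binomial_lower_bound[OF N])
  then have "4 ^ N \<le> 2 * real (N * ((2 * N) choose N))" using N by (simp add: field_simps)
  ultimately show ?thesis by simp
qed

text \<open>If \<open>q\<close> is the largest prime up to \<open>2 * N\<close>, the previous bound
  with \<open>Y = q\<close> makes \<open>q\<close> at least of order \<open>X / ln X\<close>, which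
  exceeds any power below the first. The loss \<open>\<eta>\<close> is later absorbed by
  \<open>\<epsilon>\<close>.\<close>

lemma exists_prime_powr_le:
  fixes \<eta> :: real
  assumes \<eta>: "\<eta> > 0"
  shows "\<forall>\<^sub>F X in at_top. \<exists>q. prime q \<and> X powr (1 - \<eta>) \<le> real q \<and> real q \<le> X"
proof -
  have "((\<lambda>X::real. X powr (- \<eta>) * ln X) \<longlongrightarrow> 0) at_top"
    using \<eta> by real_asymp
  then have "\<forall>\<^sub>F X in at_top. X powr (- \<eta>) * ln X < 1 / 4"
    by (rule order_tendstoD) simp
  \<comment> \<open>Beyond \<open>8\<close>, \<open>X / 4\<close> exceeds \<open>2\<close>, which
    covers both \<open>ln 2\<close> and the \<open>1\<close> lost by rounding \<open>X / 2\<close>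
    down.\<close>
  then show ?thesis using eventually_gt_at_top[of 8]
  proof eventually_elim
    case (elim X)
    have "X powr (1 - \<eta>) * ln X = X * (X powr (- \<eta>) * ln X)"
      using elim(2) by (simp add: powr_diff powr_minus field_simps)
    also have "\<dots> < X * (1 / 4)" using elim by (intro mult_strict_left_mono) auto
    finally have small: "X powr (1 - \<eta>) * ln X < X / 4" by simp
    have "ln 4 = 2 * ln (2::real)" using ln_realpow[of 2 2] by simp
    then have ln: "ln 2 \<le> (1::real)" "ln 4 \<ge> (1::real)" using ln_2_less_1 ln2_ge_two_thirds by linarith+
    have "(X / 2 - 1) * 1 \<le> (X / 2 - 1) * ln 4" using elim(2) ln by (intro mult_left_mono) auto
    moreover have "ln 2 + X powr (1 - \<eta>) * ln X < (X / 2 - 1) * 1"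
      using small ln(1) elim(2) by simp
    ultimately have main: "ln 2 + X powr (1 - \<eta>) * ln X < (X / 2 - 1) * ln 4" by linarith
    define N where "N = nat \<lfloor>X / 2\<rfloor>"
    have N: "N > 0" "2 * real N \<le> X" "X / 2 - 1 \<le> real N"
      using elim(2) by (simp_all add: N_def) linarith+
    define q where "q = Max {q. prime q \<and> q \<le> 2 * N}"
    have fin: "finite {q. prime q \<and> q \<le> 2 * N}" by simp
    have "2 \<in> {q. prime q \<and> q \<le> 2 * N}" using N by (simp add: two_is_prime_nat)
    then have "q \<in> {q. prime q \<and> q \<le> 2 * N}" unfolding q_def using fin Max_in by blast
    then have q: "prime q" "q \<le> 2 * N" by auto
    have "4 ^ N \<le> 2 * (2 * real N) ^ q"
      by (rule four_power_le_of_primes_bounded[OF N(1)]) (simp add: q_def fin)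
    also have "\<dots> \<le> 2 * X ^ q" using N by (intro mult_left_mono power_mono) auto
    finally have "ln (4 ^ N) \<le> ln (2 * X ^ q)" using elim by (subst ln_le_cancel_iff) auto
    then have "N * ln 4 \<le> ln 2 + q * ln X" using elim by (simp add: ln_mult ln_realpow)
    moreover have "(X / 2 - 1) * ln 4 \<le> N * ln 4" using N by (intro mult_right_mono) auto
    ultimately have "X powr (1 - \<eta>) * ln X < q * ln X" using main by linarith
    then have "X powr (1 - \<eta>) < q" using elim by (simp add: mult_less_cancel_right)
    moreover have "real q \<le> X" using q N by linarith
    ultimately show ?case using q by (intro exI[of _ q]) auto
  qed
qed

section \<open>From random parameters to the bound\<close>

lemma cis_root_of_unity_mod:
  fixes x :: int and r N :: nat
  assumes "N > 0"
  shows "cis (- 2 * pi * r / N * (x mod int N)) = cis (- 2 * pi * r / N * x)"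
proof -
  define k where "k = - (int r * (x div int N))"
  have "x = int N * (x div int N) + x mod int N" by simp
  then have "real_of_int x = real N * real_of_int (x div int N) + real_of_int (x mod int N)"
    by (metis of_int_add of_int_mult of_int_of_nat_eq)
  then have "- 2 * pi * r / N * x = - 2 * pi * r / N * (x mod int N) + 2 * pi * of_int k"
    using assms by (simp add: k_def field_simps)
  then have "cis (- 2 * pi * r / N * x) = cis (- 2 * pi * r / N * (x mod int N)) * cis (2 * pi * of_int k)"
    by (simp only: cis_mult)
  also have "cis (2 * pi * of_int k) = 1" by (rule cis_multiple_2pi) simp
  finally show ?thesis by simp
qed

text \<open>Shifting the summation variable multiplies the sum by \<open>cis \<theta>\<close>, which
  differs from \<open>1\<close>.\<close>

lemma sum_roots_of_unity_eq_0:
  fixes r N :: nat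
  assumes r: "0 < r" "r < N"
  shows "(\<Sum>x\<in>{0..<int N}. cis (- 2 * pi * r / N * x)) = 0"
proof -
  define \<theta> where "\<theta> = - 2 * pi * r / N"
  define S where "S = (\<Sum>x\<in>{0..<int N}. cis (\<theta> * x))"
  have "S = (\<Sum>x\<in>{0..<int N}. cis (\<theta> * (x + 1)))"
    unfolding S_def using r cis_root_of_unity_mod[of N r]
    by (intro sum_residues_shift[symmetric, where F = "\<lambda>x. cis (\<theta> * real_of_int x)"]) (auto simp: \<theta>_def)
  also have "\<dots> = cis \<theta> * S" unfolding S_def sum_distrib_left
    by (intro sum.cong refl) (simp add: cis_mult algebra_simps)
  finally have "S * (1 - cis \<theta>) = 0" by (simp add: algebra_simps)
  moreover have "cis \<theta> \<noteq> 1"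
  proof
    assume "cis \<theta> = 1"
    then have "cos \<theta> = 1" by (metis cis.sel(1) one_complex.sel(1))
    then obtain k :: int where "\<theta> = of_int k * 2 * pi" by (auto simp: cos_one_2pi_int)
    then have "pi * (real r + of_int k * real N) = 0" using r by (simp add: \<theta>_def field_simps)
    then have "real_of_int (int r + k * int N) = 0" by simp
    then have "int r = int N * (- k)" by (simp add: algebra_simps del: of_int_add of_int_mult)
    then have "int N dvd int r" by (metis dvd_triv_left)
    then have "N dvd r" by simp
    then show False using r by (auto dest: dvd_imp_le)
  qed
  ultimately show ?thesis by (simp add: S_def \<theta>_def)
qed

lemma fourier_coeff_conv_cis:
  "fourier_coeff N A r = (\<Sum>x\<in>A. cis (- 2 * pi * r / N * x)) / of_nat N"
  unfolding fourier_coeff_def cis_conv_exp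
  by (intro arg_cong2[where f = "(/)"] sum.cong refl arg_cong[where f = exp]) (simp add: mult_ac)

text \<open>At nonzero frequencies the constant \<open>m / N\<close> has no Fourier coefficient, so
  the set and its balanced function agree there, and the energy bound applies.\<close>

lemma exists_uniform_set:
  fixes N m :: nat and K :: real
  assumes N: "prime N" "N > 3" and m: "m \<le> N" and K: "K \<ge> 0"
    and count: "\<And>x d. \<not> int N dvd d \<Longrightarrow>
      card {(q, l) \<in> hit_params (int N). \<forall>j\<le>3. hit (int N) (int m) B q l (x + int j * d)} \<le> K * real N ^ 7"
  shows "\<exists>A\<subseteq>{..<N}. ap4_density N A \<le> K + 5 / sqrt N \<and>
    max_nontrivial_fourier N A ^ 4 \<le> (K + 5) / sqrt N \<and>
    (density N A - m / N) ^ 4 \<le> (K + 5) / sqrt N"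
proof -
  let ?n = "int N" let ?Z = "{0..<int N}"
  obtain q l where P: "card (hit_progressions ?n m B q l) / (real N)\<^sup>2 \<le> K + 5 / sqrt N"
    and U: "(\<Sum>h\<in>?Z. (\<Sum>x\<in>?Z. balanced ?n m B q l x * balanced ?n m B q l (x + h))\<^sup>2) / N ^ 3 \<le> (K + 5) / sqrt N"
    using exists_hit_params[of ?n m K B] N m K count by auto
  define H where "H = hit ?n m B q l"
  have H_mod: "H (x mod ?n) = H x" for x by (simp add: H_def hit_mod)
  define A where "A = {x \<in> {..<N}. H (int x)}"
  define g where "g = balanced ?n m B q l"
  have g: "g x = of_bool (H x) - m / N" for x by (simp add: g_def H_def balanced_def)
  have N0: "real N > 0" using N by simp
  have Z: "?Z = int ` {..<N}" by (simp add: lessThan_atLeast0 image_int_atLeastLessThan)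
  have fb: "norm ((\<Sum>x\<in>?Z. g x * cis (- 2 * pi * r / N * x)) / of_nat N) ^ 4 \<le> (K + 5) / sqrt N" for r :: nat
  proof -
    have "norm (\<Sum>x\<in>?Z. g x * cis (- 2 * pi * r / N * x)) ^ 4 \<le>
        N * (\<Sum>h\<in>?Z. (\<Sum>x\<in>?Z. g x * g (x + h))\<^sup>2)"
      using norm_cis_sum_pow4_le[of ?n g "- 2 * pi * r / N"] N0 cis_root_of_unity_mod[of N r]
      by (simp add: g H_mod)
    then have "norm ((\<Sum>x\<in>?Z. g x * cis (- 2 * pi * r / N * x)) / of_nat N) ^ 4 \<le>
        N * (\<Sum>h\<in>?Z. (\<Sum>x\<in>?Z. g x * g (x + h))\<^sup>2) / N ^ 4"
      unfolding norm_divide power_divide norm_of_nat of_nat_power by (intro divide_right_mono) auto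
    also have "\<dots> = (\<Sum>h\<in>?Z. (\<Sum>x\<in>?Z. g x * g (x + h))\<^sup>2) / N ^ 3"
      using N0 by (simp add: power_numeral_reduce)
    finally show ?thesis using U unfolding g_def by linarith
  qed
  have split: "(\<Sum>x\<in>?Z. g x * cis (- 2 * pi * r / N * x)) =
      (\<Sum>x\<in>A. cis (- 2 * pi * r / N * x)) - of_real (m / N) * (\<Sum>x\<in>?Z. cis (- 2 * pi * r / N * x))" for r :: nat
  proof -
    have "(\<Sum>x\<in>?Z. g x * cis (- 2 * pi * r / N * x)) =
      (\<Sum>x\<in>?Z. of_bool (H x) * cis (- 2 * pi * r / N * x)) - of_real (m / N) * (\<Sum>x\<in>?Z. cis (- 2 * pi * r / N * x))"
      unfolding sum_distrib_left sum_subtractf[symmetric]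
      by (intro sum.cong refl) (simp add: g algebra_simps)
    also have "(\<Sum>x\<in>?Z. of_bool (H x) * cis (- 2 * pi * r / N * x)) =
        (\<Sum>x\<in>{..<N}. of_bool (H (int x)) * cis (- 2 * pi * r / N * x))"
      unfolding Z by (subst sum.reindex) auto
    also have "\<dots> = (\<Sum>x\<in>A. cis (- 2 * pi * r / N * x))"
      unfolding A_def by (intro sum.mono_neutral_cong_right) auto
    finally show ?thesis .
  qed
  have coeff: "norm (fourier_coeff N A r) ^ 4 \<le> (K + 5) / sqrt N" if "0 < r" "r < N" for r
    using fb[of r] unfolding split sum_roots_of_unity_eq_0[OF that] fourier_coeff_conv_cis by simp
  have "{r. r < N \<and> r \<noteq> 0} \<noteq> {}" using N by (auto intro!: exI[of _ 1])
  then have "max_nontrivial_fourier N A \<in> (\<lambda>r. norm (fourier_coeff N A r)) ` {r. r < N \<and> r \<noteq> 0}"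
    unfolding max_nontrivial_fourier_def by (intro Max_in) auto
  then have 1: "max_nontrivial_fourier N A ^ 4 \<le> (K + 5) / sqrt N" using coeff by auto
  \<comment> \<open>At frequency \<open>0\<close> the same bound controls the mean of the balanced
    function, so the density is close to \<open>m / N\<close> without a separate argument.\<close>
  have "((\<Sum>x\<in>?Z. g x * cis (- 2 * pi * (0::nat) / N * x)) / of_nat N) = of_real (density N A - m / N)"
    unfolding split using N0 by (simp add: density_def field_simps)
  then have "\<bar>density N A - m / N\<bar> ^ 4 \<le> (K + 5) / sqrt N" using fb[of 0] by (simp only: norm_of_real)
  then have 2: "(density N A - m / N) ^ 4 \<le> (K + 5) / sqrt N" by simp
  define T where "T = {(x, d). x \<in> {..<N} \<and> d \<in> {..<N} \<and> x \<in> A \<and> (x + d) mod N \<in> A \<and>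
                         (x + 2 * d) mod N \<in> A \<and> (x + 3 * d) mod N \<in> A}"
  have inA: "x mod N \<in> A \<longleftrightarrow> H (int x)" for x
    using N0 H_mod[of "int x"] by (simp add: A_def zmod_int)
  have inA0: "x \<in> A \<longleftrightarrow> H (int x)" if "x < N" for x using that by (simp add: A_def)
  have j3: "(\<forall>j\<le>3. Q j) \<longleftrightarrow> Q 0 \<and> Q 1 \<and> Q 2 \<and> Q 3" for Q :: "nat \<Rightarrow> bool"
  proof -
    have "{..3} = {0, 1, 2, 3::nat}" by auto
    then have "(\<forall>j\<in>{..3}. Q j) \<longleftrightarrow> (\<forall>j\<in>{0, 1, 2, 3}. Q j)" by simp
    moreover have "(\<forall>j\<in>{..3}. Q j) \<longleftrightarrow> (\<forall>j\<le>3. Q j)" by auto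
    ultimately show ?thesis by simp
  qed
  have "map_prod int int ` T = hit_progressions ?n m B q l"
  proof
    show "map_prod int int ` T \<subseteq> hit_progressions ?n m B q l"
      unfolding hit_progressions_def j3 H_def[symmetric]
      by (auto simp: T_def inA inA0)
    show "hit_progressions ?n m B q l \<subseteq> map_prod int int ` T"
    proof
      fix z assume z: "z \<in> hit_progressions ?n m B q l"
      obtain x d where xd: "z = (x, d)" by (cases z)
      have r: "x \<in> ?Z" "d \<in> ?Z" and h: "H x" "H (x + d)" "H (x + 2 * d)" "H (x + 3 * d)"
        using z unfolding xd hit_progressions_def j3 H_def[symmetric] by auto
      obtain x' d' where x': "x = int x'" "d = int d'" using r by (meson atLeastLessThan_iff zero_le_imp_eq_int)
      have "(x', d') \<in> T" using r h unfolding x' by (simp add: T_def inA inA0)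
      then show "z \<in> map_prod int int ` T" unfolding xd x' by force
    qed
  qed
  moreover have "inj_on (map_prod int int) T" by (auto simp: inj_on_def)
  ultimately have "card T = card (hit_progressions ?n m B q l)" by (metis card_image)
  then have "ap4_density N A \<le> K + 5 / sqrt N" using P unfolding ap4_density_def T_def by simp
  with 1 2 show ?thesis by (intro exI[of _ A]) (auto simp: A_def)
qed

text \<open>All errors are powers of \<open>1 / sqrt N\<close> times bounded factors, and rounding
  \<open>\<alpha> * N\<close> costs at most \<open>1 / N\<close>; along a sequence of primes only
  the limit of \<open>\<kappa>\<close> survives.\<close>

lemma rho4_le_lim:
  fixes \<alpha> L :: real and \<kappa> :: "nat \<Rightarrow> real"
  assumes \<kappa>: "\<kappa> \<longlonglongrightarrow> L" and \<alpha>: "\<alpha> \<ge> 0"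
    and sets: "\<And>N. N \<ge> N0 \<Longrightarrow> prime N \<Longrightarrow> \<exists>A\<subseteq>{..<N}. ap4_density N A \<le> \<kappa> N + 5 / sqrt N \<and>
      max_nontrivial_fourier N A ^ 4 \<le> (\<kappa> N + 5) / sqrt N \<and>
      (density N A - nat \<lfloor>\<alpha> * N\<rfloor> / N) ^ 4 \<le> (\<kappa> N + 5) / sqrt N"
  shows "rho4 \<alpha> \<le> ereal L"
proof -
  have "\<forall>j. \<exists>p. prime p \<and> j + N0 < (p::nat)" using bigger_prime by blast
  \<comment> \<open>Exceeding \<open>j + N0\<close> secures the threshold \<open>N0\<close> and the
    divergence of \<open>N\<close> at once.\<close>
  then obtain N where N: "\<And>j. prime (N j)" "\<And>j. j + N0 < N j" by metis
  obtain A where A: "\<And>j. A j \<subseteq> {..<N j}" "\<And>j. ap4_density (N j) (A j) \<le> \<kappa> (N j) + 5 / sqrt (N j)"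
    "\<And>j. max_nontrivial_fourier (N j) (A j) ^ 4 \<le> (\<kappa> (N j) + 5) / sqrt (N j)"
    "\<And>j. (density (N j) (A j) - nat \<lfloor>\<alpha> * N j\<rfloor> / N j) ^ 4 \<le> (\<kappa> (N j) + 5) / sqrt (N j)"
    using sets[OF _ N(1)] N(2) by (metis add_leD2 less_imp_le)
  have Ntop: "filterlim N at_top sequentially"
    by (rule filterlim_at_top_mono[OF filterlim_ident]) (use N(2) less_imp_le add_leD1 in \<open>intro always_eventually allI, blast\<close>)
  have sq: "(\<lambda>N. c / sqrt (real N)) \<longlonglongrightarrow> 0" for c
    by real_asymp
  have lim1: "(\<lambda>j. \<kappa> (N j) + 5 / sqrt (N j)) \<longlonglongrightarrow> L"
    using filterlim_compose[OF tendsto_add[OF \<kappa> sq[of 5]] Ntop] by simp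
  have "(\<lambda>N. (\<kappa> N + 5) * (1 / sqrt N)) \<longlonglongrightarrow> (L + 5) * 0"
    by (intro tendsto_intros \<kappa> sq)
  then have lim2: "(\<lambda>j. root 4 ((\<kappa> (N j) + 5) / sqrt (N j))) \<longlonglongrightarrow> 0"
    using tendsto_real_root[OF filterlim_compose[OF _ Ntop], of "\<lambda>N. (\<kappa> N + 5) / sqrt N" 0 4] by simp
  have root: "\<bar>x\<bar> \<le> root 4 b" if "x ^ 4 \<le> b" for x b :: real
  proof -
    have "\<bar>x\<bar> = root 4 (\<bar>x\<bar> ^ 4)" by (rule real_root_power_cancel[symmetric]) auto
    also have "\<dots> \<le> root 4 b" using that by simp
    finally show ?thesis .
  qed
  have F: "(\<lambda>j. max_nontrivial_fourier (N j) (A j)) \<longlonglongrightarrow> 0"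
    by (rule Lim_null_comparison[OF _ lim2]) (use A(3) root in \<open>auto intro!: always_eventually\<close>)
  have D1: "(\<lambda>j. density (N j) (A j) - nat \<lfloor>\<alpha> * N j\<rfloor> / N j) \<longlonglongrightarrow> 0"
    by (rule Lim_null_comparison[OF _ lim2]) (use A(4) root in \<open>auto intro!: always_eventually\<close>)
  have "(\<lambda>N. real (nat \<lfloor>\<alpha> * real N\<rfloor>) / real N - \<alpha>) \<longlonglongrightarrow> 0"
  proof (rule Lim_null_comparison[OF _ lim_1_over_n])
    show "\<forall>\<^sub>F N in sequentially. norm (real (nat \<lfloor>\<alpha> * real N\<rfloor>) / real N - \<alpha>) \<le> 1 / real N"
      using eventually_gt_at_top[of 0]
    proof eventually_elim
      case (elim N)
      have "real (nat \<lfloor>\<alpha> * real N\<rfloor>) = of_int \<lfloor>\<alpha> * real N\<rfloor>" using \<alpha> by simp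
      moreover have "\<bar>of_int \<lfloor>\<alpha> * real N\<rfloor> - \<alpha> * real N\<bar> \<le> 1" by linarith
      ultimately have "\<bar>real (nat \<lfloor>\<alpha> * real N\<rfloor>) - \<alpha> * real N\<bar> / real N \<le> 1 / real N"
        by (intro divide_right_mono) auto
      moreover have "real (nat \<lfloor>\<alpha> * real N\<rfloor>) / real N - \<alpha> = (real (nat \<lfloor>\<alpha> * real N\<rfloor>) - \<alpha> * real N) / real N"
        using elim by (simp add: field_simps)
      ultimately show ?case by (simp add: abs_divide)
    qed
  qed
  from tendsto_add[OF D1 filterlim_compose[OF this Ntop]]
  have "(\<lambda>j. density (N j) (A j) - \<alpha>) \<longlonglongrightarrow> 0" by simp
  then have D: "(\<lambda>j. density (N j) (A j)) \<longlonglongrightarrow> \<alpha>" by (simp add: LIM_zero_iff)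
  have "fourier_uniform_seq N A" using N(1) Ntop A(1) F by (simp add: fourier_uniform_seq_def)
  then have "rho4 \<alpha> \<le> liminf (\<lambda>j. ereal (ap4_density (N j) (A j)))"
    unfolding rho4_def using D by (intro Inf_lower) blast
  also have "\<dots> \<le> liminf (\<lambda>j. ereal (\<kappa> (N j) + 5 / sqrt (N j)))"
    by (rule Liminf_mono) (use A(2) in auto)
  also have "\<dots> = ereal L" by (rule lim_imp_Liminf) (use lim1 in auto)
  finally show ?thesis .
qed

text \<open>The trivial count of all parameters gives \<open>K = 1\<close>. The content is that
  Fourier-uniform sequences of density \<open>\<alpha>\<close> exist, as an infimum over the empty
  set would be infinite.\<close>

lemma rho4_le_1:
  assumes \<alpha>: "0 \<le> \<alpha>" "\<alpha> \<le> 1"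
  shows "rho4 \<alpha> \<le> ereal 1"
proof (rule rho4_le_lim[where \<kappa> = "\<lambda>_. 1" and ?N0.0 = 4])
  fix N :: nat assume N: "N \<ge> 4" "prime N"
  have "\<alpha> * N \<le> 1 * real N" using \<alpha> by (intro mult_right_mono) auto
  then have m: "nat \<lfloor>\<alpha> * N\<rfloor> \<le> N" by (simp add: nat_le_iff floor_le_iff)
  have "real (card {(q, l) \<in> hit_params (int N). P q l}) \<le> 1 * real N ^ 7" for P
  proof -
    have "card {(q, l) \<in> hit_params (int N). P q l} \<le> card (hit_params (int N))"
      by (rule card_mono) (auto simp: finite_hit_params)
    then show ?thesis using card_hit_params[of "int N"] by simp
  qed
  then show "\<exists>A\<subseteq>{..<N}. ap4_density N A \<le> 1 + 5 / sqrt N \<and> max_nontrivial_fourier N A ^ 4 \<le> (1 + 5) / sqrt N \<and>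
      (density N A - nat \<lfloor>\<alpha> * N\<rfloor> / N) ^ 4 \<le> (1 + 5) / sqrt N"
    by (intro exists_uniform_set[OF N(2) _ m]) (use N in auto)
qed (use \<alpha> in auto)

lemma rho4_le_cube_div_square:
  fixes \<alpha> :: real and p :: nat
  assumes \<alpha>: "0 \<le> \<alpha>" "2000 * p * \<alpha> \<le> 1" and p: "prime p" "p > 3"
  shows "rho4 \<alpha> \<le> ereal (\<alpha> ^ 3 / p\<^sup>2)"
proof (rule rho4_le_lim[where \<kappa> = "\<lambda>N. \<alpha> ^ 3 * (1 / p + 1 / N)\<^sup>2" and ?N0.0 = "5000 * p"])
  have "(\<lambda>N. \<alpha> ^ 3 * (1 / p + 1 / N)\<^sup>2) \<longlonglongrightarrow> \<alpha> ^ 3 * (1 / p + 0)\<^sup>2"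
    by (intro tendsto_intros lim_1_over_n)
  then show "(\<lambda>N. \<alpha> ^ 3 * (1 / p + 1 / N)\<^sup>2) \<longlonglongrightarrow> \<alpha> ^ 3 / p\<^sup>2" by (simp add: power_divide)
next
  obtain c where c: "\<And>t. \<not> int p dvd t ^ 3 - t - c" using exists_irreducible_cubic[of "int p"] p by auto
  fix N :: nat assume N: "N \<ge> 5000 * p" "prime N"
  define m where "m = nat \<lfloor>\<alpha> * N\<rfloor>"
  have p0: "real p > 0" and N0: "real N > 0" using p N prime_gt_0_nat by auto
  have m: "real m \<le> \<alpha> * N" using \<alpha> by (simp add: m_def)
  have "\<alpha> \<le> 1 / (2000 * p)" using \<alpha>(2) p0 by (simp add: field_simps)
  then have "\<alpha> * N \<le> 1 / (2000 * p) * N" using N0 by (intro mult_right_mono) auto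
  then have mp: "real m \<le> N / (2000 * p)" using m by simp
  have Np: "real N / p \<ge> 5000" using N(1) p0 by (simp add: field_simps flip: of_nat_mult)
  \<comment> \<open>\<open>4 * m\<close> takes at most half of \<open>N / (250 * p)\<close>. The
    other half is at least \<open>10\<close> because \<open>N \<ge> 5000 * p\<close>, enough for the
    \<open>8\<close> and the unit lost by \<open>div\<close>.\<close>
  have w: "4 * int m + 8 < int N div (250 * int p)"
  proof -
    have "real N / (250 * p) < real_of_int (int N div (250 * int p)) + 1"
      using floor_divide_of_int_eq[of "int N" "250 * int p", where ?'a = real] by (simp, linarith)
    moreover have "4 * real m + 9 \<le> real N / (250 * p)" using mp Np by (simp add: field_simps)
    ultimately have "real_of_int (4 * int m + 8) < real_of_int (int N div (250 * int p))" by simp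
    then show ?thesis by (simp only: of_int_less_iff)
  qed
  have "N / (2000 * p) \<le> N" using p0 N0 by (simp add: field_simps)
  then have mN: "m \<le> N" using mp by linarith
  show "\<exists>A\<subseteq>{..<N}. ap4_density N A \<le> \<alpha> ^ 3 * (1 / p + 1 / N)\<^sup>2 + 5 / sqrt N \<and>
      max_nontrivial_fourier N A ^ 4 \<le> (\<alpha> ^ 3 * (1 / p + 1 / N)\<^sup>2 + 5) / sqrt N \<and>
      (density N A - nat \<lfloor>\<alpha> * N\<rfloor> / N) ^ 4 \<le> (\<alpha> ^ 3 * (1 / p + 1 / N)\<^sup>2 + 5) / sqrt N"
    unfolding m_def[symmetric]
  proof (rule exists_uniform_set[OF N(2) _ mN, where B = "base (int N) (int p) c"])
    show "3 < N" using N(1) p by linarith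
    show "0 \<le> \<alpha> ^ 3 * (1 / p + 1 / N)\<^sup>2" using \<alpha> by simp
    fix x d :: int assume d: "\<not> int N dvd d"
    have "card {(q, l) \<in> hit_params (int N). \<forall>j\<le>3. hit (int N) (int m) (base (int N) (int p) c) q l (x + int j * d)}
        \<le> nat (int m) ^ 3 * (nat (int N * (int N div int p + 1)))\<^sup>2"
      by (rule card_progression_hits_base_le) (use N p d c w in auto)
    also have "\<dots> = m ^ 3 * (N * (N div p + 1))\<^sup>2"
      by (simp add: nat_mult_distrib nat_add_distrib flip: zdiv_int)
    finally have "real (card {(q, l) \<in> hit_params (int N). \<forall>j\<le>3. hit (int N) (int m) (base (int N) (int p) c) q l (x + int j * d)})
        \<le> real (m ^ 3 * (N * (N div p + 1))\<^sup>2)" by (rule of_nat_mono)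
    also have "\<dots> = real m ^ 3 * (real N * (real (N div p) + 1))\<^sup>2" by (simp add: distrib_left)
    also have "\<dots> \<le> (\<alpha> * N) ^ 3 * (real N * (N / p + 1))\<^sup>2"
      using m \<alpha> by (intro mult_mono power_mono mult_left_mono add_right_mono of_nat_div_le_of_nat) auto
    also have "\<dots> = \<alpha> ^ 3 * (1 / p + 1 / N)\<^sup>2 * real N ^ 7"
    proof -
      have "real N * (N / p + 1) = real N ^ 2 * (1 / p + 1 / N)"
        using N0 by (simp add: power2_eq_square algebra_simps)
      then show ?thesis by (simp add: power_mult_distrib flip: power_mult power_add)
    qed
    finally show "real (card {(q, l) \<in> hit_params (int N). \<forall>j\<le>3. hit (int N) (int m) (base (int N) (int p) c) q l (x + int j * d)})
        \<le> \<alpha> ^ 3 * (1 / p + 1 / N)\<^sup>2 * real N ^ 7" .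
  qed
qed (use \<alpha> in auto)

theorem corollary1p4:
  shows "\<forall>\<epsilon>::real. \<epsilon> > 0 \<longrightarrow>
    (\<exists>C::real. C > 0 \<and>
      (\<forall>\<alpha>::real. 0 < \<alpha> \<and> \<alpha> < 1 / 2 \<longrightarrow> rho4 \<alpha> \<le> ereal (C * \<alpha> powr (5 - \<epsilon>))))"
proof (intro allI impI)
  fix \<epsilon> :: real assume \<epsilon>: "\<epsilon> > 0"
  \<comment> \<open>Half of \<open>\<epsilon>\<close> because the prime enters squared; the cap
    \<open>1 / 2\<close>, together with \<open>X \<ge> 16\<close> below, makes the prime at least
    \<open>4\<close>.\<close>
  define \<eta> where "\<eta> = min (\<epsilon> / 2) (1 / 2)"
  have \<eta>: "\<eta> > 0" "\<eta> \<le> \<epsilon> / 2" "\<eta> \<le> 1 / 2" using \<epsilon> by (auto simp: \<eta>_def)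
  obtain X0 where X0: "\<And>X. X \<ge> X0 \<Longrightarrow> \<exists>q. prime q \<and> X powr (1 - \<eta>) \<le> real q \<and> real q \<le> X"
    using exists_prime_powr_le[OF \<eta>(1)] by (auto simp: eventually_at_top_linorder)
  define Y where "Y = max X0 16"
  \<comment> \<open>One summand for each case: \<open>2000^2\<close> comes from
    \<open>X = 1 / (2000 * \<alpha>)\<close>, and \<open>(2000 * Y)^5\<close> compensates the
    trivial bound when \<open>\<alpha>\<close> is bounded below.\<close>
  define C where "C = 2000\<^sup>2 + (2000 * Y) ^ 5"
  have Y: "Y \<ge> X0" "Y \<ge> 16" by (auto simp: Y_def)
  show "\<exists>C>0. \<forall>\<alpha>::real. 0 < \<alpha> \<and> \<alpha> < 1 / 2 \<longrightarrow> rho4 \<alpha> \<le> ereal (C * \<alpha> powr (5 - \<epsilon>))"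
  proof (intro exI[of _ C] conjI allI impI)
    show "C > 0" using Y by (simp add: C_def add_pos_nonneg)
  next
    fix \<alpha> :: real assume "0 < \<alpha> \<and> \<alpha> < 1 / 2"
    then have \<alpha>: "0 < \<alpha>" "\<alpha> < 1 / 2" by auto
    show "rho4 \<alpha> \<le> ereal (C * \<alpha> powr (5 - \<epsilon>))"
    proof (cases "2000 * Y * \<alpha> \<le> 1")
      case True
      \<comment> \<open>The largest size of prime that the condition
        \<open>2000 * p * \<alpha> \<le> 1\<close> permits.\<close>
      define X where "X = 1 / (2000 * \<alpha>)"
      have "X \<ge> Y" using True \<alpha> by (simp add: X_def field_simps)
      then have X: "X \<ge> X0" "X \<ge> 16" using Y by auto
      obtain q where q: "prime q" "X powr (1 - \<eta>) \<le> real q" "real q \<le> X" using X0[OF X(1)] by auto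
      have "4 = (16::real) powr (1 / 2)" by (simp add: powr_half_sqrt)
      also have "\<dots> \<le> X powr (1 / 2)" using X by (intro powr_mono2) auto
      also have "\<dots> \<le> X powr (1 - \<eta>)" using X \<eta> by (intro powr_mono) auto
      finally have q3: "q > 3" using q(2) by linarith
      have "2000 * q * \<alpha> \<le> 2000 * X * \<alpha>" using q \<alpha> by (intro mult_right_mono mult_left_mono) auto
      also have "\<dots> = 1" using \<alpha> by (simp add: X_def)
      finally have "rho4 \<alpha> \<le> ereal (\<alpha> ^ 3 / q\<^sup>2)"
        using \<alpha> q q3 by (intro rho4_le_cube_div_square) auto
      also have "\<alpha> ^ 3 / q\<^sup>2 \<le> C * \<alpha> powr (5 - \<epsilon>)"
      proof -
        have "(X powr (1 - \<eta>))\<^sup>2 \<le> (real q)\<^sup>2" using q(2) by (intro power_mono) auto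
        then have "\<alpha> ^ 3 / q\<^sup>2 \<le> \<alpha> ^ 3 / (X powr (1 - \<eta>))\<^sup>2"
          using \<alpha> X q3 by (intro divide_left_mono mult_pos_pos) auto
        also have "(X powr (1 - \<eta>))\<^sup>2 = X powr (2 - 2 * \<eta>)"
          using X by (simp add: power2_eq_square flip: powr_add)
        also have "\<alpha> ^ 3 / X powr (2 - 2 * \<eta>) = \<alpha> powr 3 * (2000 * \<alpha>) powr (2 - 2 * \<eta>)"
          using \<alpha> by (simp add: X_def powr_divide powr_numeral)
        also have "\<dots> = 2000 powr (2 - 2 * \<eta>) * (\<alpha> powr 3 * \<alpha> powr (2 - 2 * \<eta>))"
          using \<alpha> by (simp add: powr_mult)
        also have "\<alpha> powr 3 * \<alpha> powr (2 - 2 * \<eta>) = \<alpha> powr (5 - 2 * \<eta>)"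
          unfolding powr_add[symmetric] by simp
        also have "2000 powr (2 - 2 * \<eta>) * \<alpha> powr (5 - 2 * \<eta>) \<le> 2000 powr 2 * \<alpha> powr (5 - \<epsilon>)"
          using \<alpha> \<eta> by (intro mult_mono powr_mono powr_mono') auto
        also have "\<dots> \<le> C * \<alpha> powr (5 - \<epsilon>)"
          using Y by (intro mult_right_mono) (auto simp: C_def powr_numeral)
        finally show ?thesis .
      qed
      finally show ?thesis by simp
    next
      case False
      have "rho4 \<alpha> \<le> ereal 1" using \<alpha> by (intro rho4_le_1) auto
      also have "1 \<le> (2000 * Y * \<alpha>) ^ 5" using False by (intro one_le_power) auto
      also have "\<dots> = (2000 * Y) ^ 5 * \<alpha> powr 5" using \<alpha> by (simp add: power_mult_distrib powr_numeral)
      also have "\<dots> \<le> C * \<alpha> powr (5 - \<epsilon>)"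
        using \<alpha> \<epsilon> Y by (intro mult_mono powr_mono') (auto simp: C_def)
      finally show ?thesis by simp
    qed
  qed
qed

end
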